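(* Let $p$ be a prime, let $P$ be a metabelian $p$-group and let $\chi\in\mathrm{Irr}(P)$. Then: (1) $\mathrm{Supp}(\chi)$ contains at most $|P|/\chi(1)^2$ conjugacy classes of $P$. (2) If $p$ is odd, each element of $\mathrm{Supp}(\chi)$ has order at most $|P|/\chi(1)^{3/2}$.
   Context: A $p$-group is a finite group whose order is a power of the prime $p$. $\mathrm{Irr}(P)$ denotes the set of complex irreducible characters of $P$. For $\chi\in\mathrm{Irr}(P)$, the support of $\chi$ is $\mathrm{Supp}(\chi)=\{g\in P:\chi(g)\neq 0\}$; it is a union of conjugacy classes of $P$. *)

theory Defs
  imports
    Complex_Main
    "HOL-Algebra.Generated_Groups"
    "HOL-Algebra.Group_Action"
    "HOL-Algebra.Multiplicative_Group"
    "HOL-Computational_Algebra.Primes"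
    "Jordan_Normal_Form.VS_Connect"
begin

definition p_group :: "nat \<Rightarrow> ('a, 'b) monoid_scheme \<Rightarrow> bool" where
  "p_group p G \<longleftrightarrow> group G \<and> finite (carrier G) \<and> (\<exists>k. Coset.order G = p ^ k)"

definition metabelian :: "('a, 'b) monoid_scheme \<Rightarrow> bool" where
  "metabelian G \<longleftrightarrow> group G \<and> comm_group (G\<lparr>carrier := derived G (carrier G)\<rparr>)"

definition conj_classes :: "('a, 'b) monoid_scheme \<Rightarrow> 'a set set" where
  "conj_classes G =
     orbits G (carrier G) (\<lambda>g. \<lambda>h \<in> carrier G. g \<otimes>\<^bsub>G\<^esub> h \<otimes>\<^bsub>G\<^esub> inv\<^bsub>G\<^esub> g)"

abbreviation GL :: "nat \<Rightarrow> complex mat monoid" where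
  "GL n \<equiv> units_of (ring_mat TYPE(complex) n ())"

definition representation ::
  "('a, 'b) monoid_scheme \<Rightarrow> nat \<Rightarrow> ('a \<Rightarrow> complex mat) \<Rightarrow> bool" where
  "representation G n \<rho> \<longleftrightarrow> \<rho> \<in> hom G (GL n)"

definition irreducible_representation ::
  "('a, 'b) monoid_scheme \<Rightarrow> nat \<Rightarrow> ('a \<Rightarrow> complex mat) \<Rightarrow> bool" where
  "irreducible_representation G n \<rho> \<longleftrightarrow> representation G n \<rho> \<and> 0 < n \<and>
     (\<forall>W. VectorSpace.subspace class_ring W (module_vec TYPE(complex) n) \<longrightarrow>
          (\<forall>g \<in> carrier G. \<forall>w \<in> W. \<rho> g *\<^sub>v w \<in> W) \<longrightarrow>
          W = {0\<^sub>v n} \<or> W = carrier_vec n)"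

definition mat_trace :: "complex mat \<Rightarrow> complex" where
  "mat_trace A = (\<Sum>i<dim_row A. A $$ (i, i))"

definition character_of ::
  "('a, 'b) monoid_scheme \<Rightarrow> ('a \<Rightarrow> complex mat) \<Rightarrow> 'a \<Rightarrow> complex" where
  "character_of G \<rho> = (\<lambda>g \<in> carrier G. mat_trace (\<rho> g))"

definition Irr :: "('a, 'b) monoid_scheme \<Rightarrow> ('a \<Rightarrow> complex) set" where
  "Irr G = {character_of G \<rho> | \<rho> n. irreducible_representation G n \<rho>}"

definition Supp :: "('a, 'b) monoid_scheme \<Rightarrow> ('a \<Rightarrow> complex) \<Rightarrow> 'a set" where
  "Supp G \<chi> = {g \<in> carrier G. \<chi> g \<noteq> 0}"

text \<open>For a character the value at the identity is a positive integer, namely the degree of the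
  underlying representation, so taking the real part only changes its type.\<close>

definition char_degree :: "('a, 'b) monoid_scheme \<Rightarrow> ('a \<Rightarrow> complex) \<Rightarrow> real" where
  "char_degree G \<chi> = Re (\<chi> \<one>\<^bsub>G\<^esub>)"

end

theory Submission
  imports Defs "HOL-Number_Theory.Residues"
begin

text \<open>
  Since \<open>P'\<close> is abelian, \<open>\<rho>(P')\<close> has a common eigenvector; choose an eigenvector \<open>v\<close> whose
  stabilizer \<open>B \<supseteq> P'\<close> of the line of \<open>v\<close> is maximal, with eigencharacter \<open>\<mu>\<close> on \<open>B\<close>. Maximality
  makes \<open>B\<close> the inertia group of \<open>\<mu>\<close>, so \<open>\<chi>\<close> is induced from \<open>\<mu>\<close>, \<open>\<chi>(1) = |P : B|\<close>, and \<open>\<chi>\<close> vanishes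
  off the normal subgroup \<open>B\<close>. Everything else concerns the pairing \<open>\<langle>b, x\<rangle> = \<mu>(x\<^sup>-\<^sup>1 b x)\<close> on \<open>B \<times> P\<close>.

  For (1), counting classes with Burnside weights reduces the claim to
  \<open>\<Sum> |C\<^sub>P(b)| \<le> |B|\<^sup>2\<close>, the sum over the \<open>b \<in> B\<close> with \<open>\<chi>(b) \<noteq> 0\<close>. The weighted sum is compared along
  a chain of subgroups descending from \<open>P\<close> to \<open>B\<close>: from \<open>C\<close> one passes to the kernel \<open>D\<close>, of index \<open>p\<close>
  in \<open>C\<close>, of \<open>g \<mapsto> \<langle>n, g\<rangle> / \<langle>n, 1\<rangle>\<close> for an \<open>n \<in> B\<close> whose commutators with \<open>C\<close> are central modulo the kernel
  of \<open>\<chi>\<close>, and compares the weights of \<open>b, b n, \<dots>, b n\<^sup>p\<^sup>-\<^sup>1\<close>.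

  For (2), let \<open>S\<close> be the stabilizer of \<open>f \<in> Supp(\<chi>)\<close> modulo the kernel, \<open>T\<close> the subgroup of \<open>B\<close> fixed
  by \<open>S\<close>, and \<open>p\<^sup>e\<close>, \<open>p\<^sup>j\<close> the order of \<open>f\<close> and the index of the group generated by \<open>f\<close> in \<open>T\<close>, both modulo the kernel.
  Orthogonality gives \<open>|S| |T| \<le> |B|\<^sup>2\<close>, so it suffices that \<open>f\<close> has at most \<open>p\<^sup>2\<^sup>j\<close> conjugates. If \<open>e \<le> j\<close>,
  that is trivial. Otherwise \<open>f\<close> to the power \<open>p\<^sup>e\<^sup>-\<^sup>1\<close> is central, so for odd \<open>p\<close> no conjugate of \<open>f\<close>
  is a power of \<open>f\<close> other than \<open>f\<close> itself: otherwise \<open>f\<close> would be conjugate to \<open>f z\<close> with \<open>z \<noteq> 1\<close> central and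
  \<open>\<chi>(f)\<close> would vanish. Hence the \<open>p\<^sup>e\<^sup>-\<^sup>1\<close> powers of the conjugates with exponents
  \<open>\<equiv> 1 (mod p)\<close> are distinct.
\<close>

section \<open>Powers modulo primes and counting in groups\<close>

lemma geometric_sum_cong:
  fixes a p :: int
  shows "p\<^sup>2 dvd (\<Sum>i<n. (1 + p * a) ^ i) - (int n + p * a * (\<Sum>i<n. int i))"
proof -
  \<comment> \<open>Binomial expansion to first order in \<open>p\<close>; summing it over
    \<open>i\<close> gives the claim.\<close>
  have pow: "p\<^sup>2 dvd (1 + p * a) ^ i - (1 + p * a * int i)" for i
  proof (induction i)
    case (Suc i)
    have "(1 + p * a) ^ Suc i - (1 + p * a * int (Suc i))
        = (1 + p * a) * ((1 + p * a) ^ i - (1 + p * a * int i)) + p\<^sup>2 * (a\<^sup>2 * int i)"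
      by (simp add: algebra_simps power2_eq_square)
    with Suc show ?case by (metis dvd_add dvd_mult dvd_triv_left)
  qed simp
  have "(\<Sum>i<n. (1 + p * a) ^ i) - (int n + p * a * (\<Sum>i<n. int i))
      = (\<Sum>i<n. (1 + p * a) ^ i - (1 + p * a * int i))"
    by (simp add: sum.distrib sum_subtractf sum_distrib_left)
  then show ?thesis using pow by (simp add: dvd_sum)
qed

text \<open>The cofactor of w - 1 in w^p - 1 is a geometric sum, evaluated modulo p^2. For odd
  \<open>p\<close> the exponents add up to p (p - 1) / 2, a multiple of \<open>p\<close>, so the
  first-order term vanishes and the cofactor is \<open>p\<close> times a number congruent to 1
  modulo \<open>p\<close>.\<close>

lemma power_prime_minus_one:
  fixes w :: int and p :: nat
  assumes "prime p" "odd p" "int p dvd w - 1"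
  obtains c where "w ^ p - 1 = (w - 1) * (int p * (1 + int p * c))"
proof -
  obtain a where a: "w = 1 + int p * a"
    using assms(3) by (metis add.commute diff_add_cancel dvdE)
  obtain h where h: "p = 2 * h + 1" using assms(2) oddE by blast
  have "(\<Sum>i<n. int i) * 2 = int n * (int n - 1)" for n
    by (induction n) (auto simp: algebra_simps)
  from this[of p] have "(\<Sum>i<p. int i) = int p * int h"
    unfolding h by (simp add: algebra_simps)
  then have "(int p)\<^sup>2 dvd (\<Sum>i<p. w ^ i) - (int p + (int p)\<^sup>2 * (a * int h))"
    using geometric_sum_cong[of "int p" a p] unfolding a by (simp add: power2_eq_square algebra_simps)
  then obtain d where "(\<Sum>i<p. w ^ i) - (int p + (int p)\<^sup>2 * (a * int h)) = (int p)\<^sup>2 * d" by blast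
  then have "(\<Sum>i<p. w ^ i) = int p * (1 + int p * (a * int h + d))"
    by (simp add: algebra_simps power2_eq_square)
  then show thesis using that[of "a * int h + d"] power_diff_1_eq[of w p] by simp
qed

text \<open>The cofactor found above is \<open>p\<close> times a number prime to \<open>p\<close>,
  so the p-adic valuation rises by exactly one.\<close>

lemma prime_power_dvd_power_diff:
  fixes w :: int and p :: nat
  assumes "prime p" "odd p" "int p dvd w - 1"
  shows "int p ^ Suc e dvd w ^ p - 1 \<longleftrightarrow> int p ^ e dvd w - 1"
proof -
  obtain c where c: "w ^ p - 1 = (w - 1) * (int p * (1 + int p * c))"
    using power_prime_minus_one[OF assms] .
  have "coprime (int p) (1 + int p * c)"
    by (rule coprimeI) (metis dvd_add_left_iff dvd_mult2)
  then have cop: "coprime (int p ^ e) (1 + int p * c)" by simp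
  have "int p ^ Suc e dvd w ^ p - 1 \<longleftrightarrow> int p ^ e dvd (w - 1) * (1 + int p * c)"
    unfolding c using prime_gt_0_nat[OF assms(1)]
    by (metis (no_types, lifting) dvd_mult_cancel_left mult.assoc mult.commute of_nat_0_less_iff order_less_irrefl power_Suc)
  then show ?thesis using cop by (simp add: coprime_dvd_mult_left_iff)
qed

text \<open>From u^(p^r) to u^(p^(r+1)) the valuation of the distance to 1 rises by exactly one; it
  starts at most at \<open>e\<close>, so it meets \<open>e\<close>.\<close>

lemma exists_power_near_one:
  fixes u :: int and p :: nat
  assumes "prime p" "odd p" "int p dvd u - 1" "\<not> int p ^ Suc e dvd u - 1"
  obtains m where "int p ^ e dvd u ^ m - 1" "\<not> int p ^ Suc e dvd u ^ m - 1"
proof -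
  have one: "int p dvd u ^ m - 1" for m
    using assms(3) power_diff_1_eq[of u m] by simp
  have lift: "int p ^ Suc r dvd u ^ (p ^ r) - 1" for r
  proof (induction r)
    case (Suc r)
    then show ?case
      using prime_power_dvd_power_diff[OF assms(1,2) one, of "Suc r" "p ^ r"]
      by (simp add: power_mult[symmetric] mult.commute)
  qed (use assms(3) in simp)
  \<comment> \<open>The first exponent that overshoots. It is positive because \<open>u\<close>
    itself does not overshoot, and its predecessor has valuation exactly \<open>e\<close>.\<close>
  define r where "r = (LEAST r. int p ^ Suc e dvd u ^ (p ^ r) - 1)"
  have r: "int p ^ Suc e dvd u ^ (p ^ r) - 1"
    unfolding r_def by (rule LeastI[of _ e]) (rule lift)
  then obtain s where s: "r = Suc s" using assms(4) by (cases r) auto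
  have "\<not> int p ^ Suc e dvd u ^ (p ^ s) - 1"
    using not_less_Least[of s "\<lambda>r. int p ^ Suc e dvd u ^ (p ^ r) - 1"] s r_def by simp
  moreover have "int p ^ e dvd u ^ (p ^ s) - 1"
    using r prime_power_dvd_power_diff[OF assms(1,2) one, of e "p ^ s"]
    unfolding s by (simp add: power_mult[symmetric] mult.commute)
  ultimately show thesis using that by blast
qed

section \<open>Fixed points of p-groups, fibre counts and factor groups\<close>

lemma (in group) group_actionI:
  assumes closed: "\<And>g x. g \<in> carrier G \<Longrightarrow> x \<in> E \<Longrightarrow> a g x \<in> E"
    and one: "\<And>x. x \<in> E \<Longrightarrow> a \<one> x = x"
    and mult: "\<And>g h x. g \<in> carrier G \<Longrightarrow> h \<in> carrier G \<Longrightarrow> x \<in> E \<Longrightarrow> a (g \<otimes> h) x = a g (a h x)"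
  shows "group_action G E (\<lambda>g. \<lambda>x\<in>E. a g x)"
proof -
  have bij: "(\<lambda>x\<in>E. a g x) \<in> Bij E" if g: "g \<in> carrier G" for g
  proof -
    have "bij_betw (a g) E E"
      by (rule bij_betw_byWitness[where f' = "a (inv g)"])
        (use g closed one mult in \<open>auto simp: mult[symmetric]\<close>)
    then show ?thesis by (simp add: Bij_def bij_betw_restrict_eq)
  qed
  have "(\<lambda>g. \<lambda>x\<in>E. a g x) \<in> hom G (BijGroup E)"
    using bij by (auto simp: hom_def BijGroup_def compose_def mult closed cong: restrict_cong)
  then show ?thesis
    unfolding group_action_def group_hom_def group_hom_axioms_def
    by (simp add: is_group group_BijGroup)
qed

text \<open>If \<open>x0\<close> were the only fixed point, all other orbits would have size
  divisible by \<open>p\<close>, and \<open>card E\<close> would be 1 modulo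
  \<open>p\<close>.\<close>

lemma (in group_action) exists_second_fixed_point:
  assumes "prime p" "Coset.order G = p ^ k" "finite E" "p dvd card E"
    and x0: "x0 \<in> E" "\<And>g. g \<in> carrier G \<Longrightarrow> \<phi> g x0 = x0"
  obtains x where "x \<in> E" "x \<noteq> x0" "\<And>g. g \<in> carrier G \<Longrightarrow> \<phi> g x = x"
proof (rule ccontr)
  assume "\<not> thesis"
  then have nofix: "\<exists>g\<in>carrier G. \<phi> g x \<noteq> x" if "x \<in> E" "x \<noteq> x0" for x
    using that \<open>\<And>x. \<lbrakk>x \<in> E; x \<noteq> x0; \<And>g. g \<in> carrier G \<Longrightarrow> \<phi> g x = x\<rbrakk> \<Longrightarrow> thesis\<close> by blast
  have "orbit G \<phi> x0 = {x0}"
    using x0 orbit_refl[OF x0(1)] by (auto simp: orbit_def)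
  then have orb0: "{x0} \<in> orbits G E \<phi>" using x0(1) by (force simp: orbits_def)
  have fin: "finite (orbits G E \<phi>)" using assms(3) by (auto simp: orbits_def)
  have dvd: "p dvd card Ob" if Ob: "Ob \<in> orbits G E \<phi> - {{x0}}" for Ob
  proof -
    obtain x where x: "x \<in> E" "Ob = orbit G \<phi> x" using Ob by (auto simp: orbits_def)
    have "x \<noteq> x0" using Ob x \<open>orbit G \<phi> x0 = {x0}\<close> by auto
    then obtain g where g: "g \<in> carrier G" "\<phi> g x \<noteq> x" using nofix x by blast
    have "x \<in> Ob" "\<phi> g x \<in> Ob" using x g orbit_refl by (auto simp: orbit_def)
    then have "card Ob \<noteq> 1" using g(2) by (metis card_1_singletonE singletonD)
    moreover have "card Ob dvd p ^ k"
      using orbit_stabilizer_theorem[OF x(1)] x(2) assms(2) by (metis dvd_triv_left)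
    ultimately show ?thesis
      using assms(1) divides_primepow_nat[of p "card Ob" k]
      by (metis dvd_power gr0I power_0)
  qed
  have "card E = (\<Sum>Y\<in>orbits G E \<phi>. card Y)"
    using disjoint_sum[OF assms(3), of "\<lambda>_. 1::nat"] orbits_coverture by simp
  also have "\<dots> = 1 + (\<Sum>Y\<in>orbits G E \<phi> - {{x0}}. card Y)"
    using sum.remove[OF fin orb0, of card] by simp
  finally have "p dvd 1 + (\<Sum>Y\<in>orbits G E \<phi> - {{x0}}. card Y)" using assms(4) by simp
  moreover have "p dvd (\<Sum>Y\<in>orbits G E \<phi> - {{x0}}. card Y)" by (rule dvd_sum) (rule dvd)
  ultimately have "p dvd 1" using dvd_add_left_iff by blast
  then show False using assms(1) by simp
qed

text \<open>Every nonempty fibre of \<open>f\<close> is a translate of \<open>K\<close>. The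
  condition is phrased through cosets so that the values of \<open>f\<close> can be complex numbers
  or functions.\<close>

lemma (in group) card_eq_card_image_mult:
  assumes "subgroup H G" "finite H" "K \<subseteq> H"
    and "\<And>x y. x \<in> H \<Longrightarrow> y \<in> H \<Longrightarrow> f x = f y \<longleftrightarrow> inv x \<otimes> y \<in> K"
  shows "card H = card (f ` H) * card K"
proof -
  have H: "x \<in> carrier G" if "x \<in> H" for x using subgroup.mem_carrier[OF assms(1) that] .
  have fibre: "card {y \<in> H. f y = z} = card K" if z: "z \<in> f ` H" for z
  proof -
    obtain x where x: "x \<in> H" "z = f x" using z by blast
    have "{y \<in> H. f y = z} = (\<lambda>k. x \<otimes> k) ` K"
    proof (intro equalityI subsetI)
      fix y assume "y \<in> {y \<in> H. f y = z}"
      then have y: "y \<in> H" "f x = f y" using x by auto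
      then have "inv x \<otimes> y \<in> K" using assms(4) x by blast
      moreover have "y = x \<otimes> (inv x \<otimes> y)"
        using H[OF x(1)] H[OF y(1)] by (simp add: m_assoc[symmetric])
      ultimately show "y \<in> (\<lambda>k. x \<otimes> k) ` K" by blast
    next
      fix y assume "y \<in> (\<lambda>k. x \<otimes> k) ` K"
      then obtain k where k: "k \<in> K" "y = x \<otimes> k" by blast
      then have kH: "k \<in> H" using assms(3) by blast
      have "inv x \<otimes> y = k" using k H[OF x(1)] H[OF kH] by (simp add: m_assoc[symmetric])
      then show "y \<in> {y \<in> H. f y = z}"
        using assms(4)[of x y] k x kH subgroup.m_closed[OF assms(1)] by simp
    qed
    moreover have "inj_on (\<lambda>k. x \<otimes> k) K"
      using H x assms(3) by (intro inj_onI) (auto simp: subset_iff)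
    ultimately show ?thesis by (simp add: card_image)
  qed
  have "card H = (\<Sum>z\<in>f ` H. card {y \<in> H. f y = z})"
    using sum.image_gen[OF assms(2), of "\<lambda>_. 1::nat" f] by simp
  then show ?thesis using fibre by simp
qed

lemma (in group) sum_translate:
  assumes C: "subgroup C G" and g: "g \<in> C"
  shows "(\<Sum>c\<in>C. f (g \<otimes> c)) = (\<Sum>c\<in>C. f c)"
proof (rule sum.reindex_bij_witness[where i = "\<lambda>c. inv g \<otimes> c" and j = "\<lambda>c. g \<otimes> c"])
  fix c assume c: "c \<in> C"
  have P: "c \<in> carrier G" "g \<in> carrier G"
    using c g subgroup.mem_carrier[OF C] by blast+
  show "inv g \<otimes> (g \<otimes> c) = c" "g \<otimes> (inv g \<otimes> c) = c"
    using P by (simp_all add: m_assoc[symmetric])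
  show "g \<otimes> c \<in> C" "inv g \<otimes> c \<in> C"
    using c g subgroup.m_closed[OF C] subgroup.m_inv_closed[OF C] by blast+
qed simp

lemma (in group) sum_translate_right:
  assumes C: "subgroup C G" and g: "g \<in> C"
  shows "(\<Sum>c\<in>C. f (c \<otimes> g)) = (\<Sum>c\<in>C. f c)"
proof (rule sum.reindex_bij_witness[where i = "\<lambda>c. c \<otimes> inv g" and j = "\<lambda>c. c \<otimes> g"])
  fix c assume c: "c \<in> C"
  have P: "c \<in> carrier G" "g \<in> carrier G"
    using c g subgroup.mem_carrier[OF C] by blast+
  show "c \<otimes> g \<otimes> inv g = c" "c \<otimes> inv g \<otimes> g = c"
    using P by (simp_all add: m_assoc)
  show "c \<otimes> g \<in> C" "c \<otimes> inv g \<in> C"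
    using c g subgroup.m_closed[OF C] subgroup.m_inv_closed[OF C] by blast+
qed simp

text \<open>The factor group of \<open>T\<close> by \<open>L\<close> has order \<open>m\<close>, so
  its \<open>m\<close>-th powers are trivial.\<close>

lemma (in group) pow_index_mem:
  assumes T: "subgroup T G" and L: "subgroup L G" and LT: "L \<subseteq> T" and fin: "finite (carrier G)"
    and normal: "\<And>x h. x \<in> T \<Longrightarrow> h \<in> L \<Longrightarrow> x \<otimes> h \<otimes> inv x \<in> L"
    and card: "card T = m * card L" and h: "h \<in> T"
  shows "h [^] m \<in> L"
proof -
  let ?T = "G\<lparr>carrier := T\<rparr>"
  interpret T: group ?T using subgroup.subgroup_is_group[OF T is_group] .
  have LT': "subgroup L ?T" using subgroup_incl[OF L T LT] .
  have "L \<lhd> ?T" using LT' normal T by (simp add: T.normal_inv_iff)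
  then interpret L: normal L ?T .
  interpret Q: group "?T Mod L" by (rule L.factorgroup_is_group)
  have finL: "finite L" using finite_subset[OF subgroup.subset[OF L] fin] .
  then have "card L > 0" using subgroup.one_closed[OF L] by (auto simp: card_gt_0_iff)
  moreover have "card (rcosets\<^bsub>?T\<^esub> L) * card L = m * card L"
    using T.lagrange[OF LT'] card by (simp add: Coset.order_def)
  ultimately have m: "Coset.order (?T Mod L) = m" by (simp add: Coset.order_def FactGroup_def)
  interpret hom: group_hom ?T "?T Mod L" "\<lambda>a. L #>\<^bsub>?T\<^esub> a"
    by unfold_locales (rule L.r_coset_hom_Mod)
  have "L #>\<^bsub>?T\<^esub> (h [^]\<^bsub>?T\<^esub> m) = (L #>\<^bsub>?T\<^esub> h) [^]\<^bsub>?T Mod L\<^esub> m"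
    using hom.hom_nat_pow[of h m] h by simp
  also have "\<dots> = L"
    using Q.pow_order_eq_1[of "L #>\<^bsub>?T\<^esub> h"] hom.hom_closed[of h] h m by simp
  finally have "L #>\<^bsub>?T\<^esub> (h [^]\<^bsub>?T\<^esub> m) = L" .
  moreover have "h [^]\<^bsub>?T\<^esub> m \<in> T" using T.nat_pow_closed[of h m] h by simp
  ultimately have "h [^]\<^bsub>?T\<^esub> m \<in> L"
    using T.coset_join1[of L "h [^]\<^bsub>?T\<^esub> m"] LT' LT by simp
  then show ?thesis using nat_pow_consistent[of h m T] by simp
qed

text \<open>Fermat's theorem iterated; in effect, a p-group acts trivially on a group of order
  \<open>p\<close>.\<close>

lemma power_prime_power_cong:
  fixes p a :: nat
  assumes "prime p"
  shows "[a ^ (p ^ k) = a] (mod p)"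
proof (induction k)
  case (Suc k)
  have fermat: "[b ^ p = b] (mod p)" for b :: nat
  proof (cases "p dvd b")
    case True
    then have "p dvd b ^ p" using dvd_trans[OF True dvd_power[of p b]] prime_gt_0_nat[OF assms] by blast
    then show ?thesis using True by (simp add: cong_def mod_eq_0_iff_dvd)
  next
    case False
    then have "[b ^ (p - 1) * b = 1 * b] (mod p)"
      by (intro cong_mult fermat_theorem assms cong_refl)
    then show ?thesis
      using prime_gt_0_nat[OF assms] by (metis Suc_diff_1 mult_1 power_Suc2)
  qed
  have "a ^ (p ^ Suc k) = (a ^ (p ^ k)) ^ p" by (simp add: power_mult[symmetric] mult.commute)
  then show ?case using fermat[of "a ^ (p ^ k)"] Suc cong_trans by metis
qed simp

section \<open>The conjugation pairing\<close>

text \<open>\<open>pr b x\<close> stands for \<open>\<mu>(x\<^sup>-\<^sup>1 b x)\<close>.\<close>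

locale conjugation_pairing = group P for P (structure) +
  fixes p k :: nat and B :: "'a set" and pr :: "'a \<Rightarrow> 'a \<Rightarrow> complex"
  assumes prime: "prime p" and fin: "finite (carrier P)" and ord_P: "Coset.order P = p ^ k"
    and B: "subgroup B P"
    and conj_closed: "g \<in> carrier P \<Longrightarrow> b \<in> B \<Longrightarrow> inv g \<otimes> b \<otimes> g \<in> B"
    and pr_mult: "b \<in> B \<Longrightarrow> c \<in> B \<Longrightarrow> x \<in> carrier P \<Longrightarrow> pr (b \<otimes> c) x = pr b x * pr c x"
    and pr_nonzero: "b \<in> B \<Longrightarrow> x \<in> carrier P \<Longrightarrow> pr b x \<noteq> 0"
    and pr_conj: "g \<in> carrier P \<Longrightarrow> x \<in> carrier P \<Longrightarrow> b \<in> B \<Longrightarrow>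
      pr (inv g \<otimes> b \<otimes> g) x = pr b (g \<otimes> x)"
    and pr_commute: "g \<in> carrier P \<Longrightarrow> h \<in> carrier P \<Longrightarrow> x \<in> carrier P \<Longrightarrow> b \<in> B \<Longrightarrow>
      pr b (g \<otimes> (h \<otimes> x)) = pr b (h \<otimes> (g \<otimes> x))"
    and inertia: "g \<in> carrier P \<Longrightarrow> g \<in> B \<longleftrightarrow> (\<forall>b\<in>B. \<forall>x\<in>carrier P. pr b (g \<otimes> x) = pr b x)"
begin

section \<open>Values of the pairing\<close>

lemma B_carrier: "b \<in> B \<Longrightarrow> b \<in> carrier P"
  by (rule subgroup.mem_carrier[OF B])

lemma finite_subgroup: "subgroup C P \<Longrightarrow> finite C"
  by (rule finite_subset[OF subgroup.subset fin])

lemma finB: "finite B"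
  using B by (rule finite_subgroup)

lemma B_pow: "b \<in> B \<Longrightarrow> b [^] (n::nat) \<in> B"
  by (induction n) (auto simp: subgroup.one_closed[OF B] subgroup.m_closed[OF B])

lemma pr_one:
  assumes "x \<in> carrier P"
  shows "pr \<one> x = 1"
proof -
  have "pr \<one> x * pr \<one> x = pr \<one> x * 1"
    using pr_mult[of \<one> \<one> x] subgroup.one_closed[OF B] assms by (metis l_one one_closed mult_1_right)
  then show ?thesis
    using pr_nonzero[of \<one> x] subgroup.one_closed[OF B] assms mult_cancel_left by blast
qed

lemma pr_inv:
  assumes "b \<in> B" "x \<in> carrier P"
  shows "pr (inv b) x = inverse (pr b x)"
proof -
  have "pr b x * pr (inv b) x = pr (b \<otimes> inv b) x"
    using pr_mult[of b "inv b" x] subgroup.m_inv_closed[OF B] assms by simp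
  also have "\<dots> = 1" using pr_one assms B_carrier by simp
  finally show ?thesis by (metis inverse_unique)
qed

lemma pr_pow: "b \<in> B \<Longrightarrow> x \<in> carrier P \<Longrightarrow> pr (b [^] (n::nat)) x = pr b x ^ n"
  by (induction n) (simp_all add: pr_one pr_mult B_pow)

lemma pr_power_order: "b \<in> B \<Longrightarrow> x \<in> carrier P \<Longrightarrow> pr b x ^ (p ^ k) = 1"
  using pr_pow[of b x "p ^ k"] pow_order_eq_1[of b] fin B_carrier[of b] ord_P pr_one by simp

lemma norm_pr:
  assumes "b \<in> B" "x \<in> carrier P"
  shows "norm (pr b x) = 1"
proof (rule power_eq_imp_eq_base)
  show "norm (pr b x) ^ (p ^ k) = 1 ^ (p ^ k)"
    using pr_power_order[OF assms] by (metis norm_power norm_one power_one)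
qed (use prime_gt_0_nat[OF prime] in auto)

lemma conj_inv_closed: "g \<in> carrier P \<Longrightarrow> b \<in> B \<Longrightarrow> g \<otimes> b \<otimes> inv g \<in> B"
  using conj_closed[of "inv g" b] by simp

lemma pr_conj_inv: "g \<in> carrier P \<Longrightarrow> x \<in> carrier P \<Longrightarrow> b \<in> B \<Longrightarrow>
    pr (g \<otimes> b \<otimes> inv g) x = pr b (inv g \<otimes> x)"
  using pr_conj[of "inv g" x b] by simp

lemma card_dvd_prime_power: "subgroup C P \<Longrightarrow> card C dvd p ^ k"
  using lagrange[of C] ord_P by (metis dvd_triv_right)

section \<open>Stabilizers modulo the kernel of \<chi>, and live elements\<close>

definition stab :: "'a set \<Rightarrow> 'a \<Rightarrow> 'a set" where
  "stab C b = {g \<in> C. \<forall>x\<in>carrier P. pr b (g \<otimes> x) = pr b x}"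

text \<open>For \<open>B \<subseteq> C\<close> the inner sum is \<open>card B\<close> times the
  value at \<open>b\<close> of the character of \<open>C\<close> induced from the conjugate
  \<open>\<lambda>b. pr b x\<close> of \<mu>. For \<open>C = carrier P\<close> the live elements
  form the support of \<chi>.\<close>

definition live :: "'a set \<Rightarrow> 'a set" where
  "live C = {b \<in> B. \<exists>x\<in>carrier P. (\<Sum>c\<in>C. pr b (c \<otimes> x)) \<noteq> 0}"

lemma stabD: "g \<in> stab C b \<Longrightarrow> x \<in> carrier P \<Longrightarrow> pr b (g \<otimes> x) = pr b x"
  by (simp add: stab_def)

lemma stab_subgroup:
  assumes "subgroup C P" "b \<in> B"
  shows "subgroup (stab C b) P"
proof (rule subgroupI)
  show "stab C b \<subseteq> carrier P"
    using subgroup.subset[OF assms(1)] by (auto simp: stab_def)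
  show "stab C b \<noteq> {}"
    using subgroup.one_closed[OF assms(1)] by (auto simp: stab_def)
next
  fix g assume g: "g \<in> stab C b"
  then have gP: "g \<in> carrier P"
    using subgroup.mem_carrier[OF assms(1)] by (simp add: stab_def)
  have "pr b (inv g \<otimes> x) = pr b x" if x: "x \<in> carrier P" for x
    using stabD[OF g, of "inv g \<otimes> x"] gP x by (simp add: m_assoc[symmetric])
  then show "inv g \<in> stab C b"
    using g subgroup.m_inv_closed[OF assms(1)] by (simp add: stab_def)
next
  fix g h assume gh: "g \<in> stab C b" "h \<in> stab C b"
  then have P: "g \<in> carrier P" "h \<in> carrier P"
    using subgroup.mem_carrier[OF assms(1)] by (simp_all add: stab_def)
  have "pr b (g \<otimes> h \<otimes> x) = pr b x" if x: "x \<in> carrier P" for x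
    using stabD[OF gh(1), of "h \<otimes> x"] stabD[OF gh(2) x] P x by (simp add: m_assoc)
  moreover have "g \<otimes> h \<in> C"
    using gh subgroup.m_closed[OF assms(1)] by (simp add: stab_def)
  ultimately show "g \<otimes> h \<in> stab C b" by (simp add: stab_def)
qed

lemma B_subset_stab: "B \<subseteq> C \<Longrightarrow> b \<in> B \<Longrightarrow> B \<subseteq> stab C b"
  unfolding stab_def using inertia[OF B_carrier] by blast

text \<open>The element \<open>n\<close> comes from a nontrivial fixed point of the \<open>p\<close>-group \<open>P\<close>, which acts by translation of
  \<open>x\<close> on the functions \<open>(g, x) \<mapsto> pr b (g \<otimes> x) / pr b x\<close> with \<open>g \<in> C\<close>.\<close>

lemma exists_semi_invariant:
  assumes C: "subgroup C P" and BC: "B \<subset> C"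
  obtains n \<zeta> where "n \<in> B"
    "\<And>g x. g \<in> C \<Longrightarrow> x \<in> carrier P \<Longrightarrow> pr n (g \<otimes> x) = \<zeta> g * pr n x"
    "\<And>g. g \<in> C \<Longrightarrow> \<zeta> g ^ p = 1" "\<exists>g\<in>C. \<zeta> g \<noteq> 1"
proof -
  note CP = subgroup.mem_carrier[OF C]
  \<comment> \<open>The default value 1 makes \<open>D\<close> multiplicative in \<open>b\<close> at
    all arguments, so that equality of functions can be used.\<close>
  define D where "D b = (\<lambda>g x. if g \<in> C \<and> x \<in> carrier P then pr b (g \<otimes> x) / pr b x else 1)" for b
  define tr where "tr y F = (\<lambda>g x. if g \<in> C \<and> x \<in> carrier P then F g (inv y \<otimes> x) else (1::complex))"
    for y and F :: "'a \<Rightarrow> 'a \<Rightarrow> complex"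
  define X where "X = D ` B"
  have tr_D: "tr y (D b) = D (y \<otimes> b \<otimes> inv y)" if "y \<in> carrier P" "b \<in> B" for y b
    using that CP by (auto simp: tr_def D_def fun_eq_iff pr_conj_inv pr_commute)
  \<comment> \<open>By multiplicativity the fibres of \<open>D\<close> are cosets of its kernel, so
    the size of the image \<open>X\<close> divides \<open>card B\<close> and is a power of
    \<open>p\<close>.\<close>
  have D_eq: "D b = D c \<longleftrightarrow> inv b \<otimes> c \<in> {b \<in> B. D b = D \<one>}" if b: "b \<in> B" "c \<in> B" for b c
  proof -
    have m: "inv b \<otimes> c \<in> B" using b B by (simp add: subgroup.m_closed subgroup.m_inv_closed)
    have "D (inv b \<otimes> c) g x = D c g x / D b g x" for g x
      using b CP subgroup.m_inv_closed[OF B]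
      by (auto simp: D_def pr_mult pr_inv pr_nonzero field_simps)
    moreover have "D b g x \<noteq> 0" for g x using b CP by (auto simp: D_def pr_nonzero)
    moreover have "D \<one> g x = 1" for g x using CP by (simp add: D_def pr_one)
    ultimately show ?thesis using m by (auto simp: fun_eq_iff)
  qed
  have cardB: "card B = card X * card {b \<in> B. D b = D \<one>}"
    unfolding X_def by (rule card_eq_card_image_mult[OF B finB]) (use D_eq in auto)
  \<comment> \<open>An element of \<open>C\<close> outside the inertia group moves some
    \<open>b\<close>, so \<open>X\<close> has more than one element and its size is divisible by
    \<open>p\<close>.\<close>
  obtain h where h: "h \<in> C" "h \<notin> B" using BC by blast
  then obtain b x where b: "b \<in> B" "x \<in> carrier P" "pr b (h \<otimes> x) \<noteq> pr b x"
    using inertia[of h] CP by blast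
  have "D b h x \<noteq> D \<one> h x"
    using b h CP by (simp add: D_def pr_one pr_nonzero)
  then have "D b \<noteq> D \<one>" by metis
  then have "card X \<noteq> 1"
    unfolding X_def using b subgroup.one_closed[OF B] by (metis card_1_singletonE imageI singletonD)
  moreover have "card X dvd p ^ k"
    using card_dvd_prime_power[OF B] cardB by (metis dvd_mult_left)
  ultimately have pX: "p dvd card X"
    using divides_primepow_nat[OF prime, of "card X" k] by (metis dvd_power gr0I power_0)
  have act: "group_action P X (\<lambda>y. \<lambda>F\<in>X. tr y F)"
  proof (rule group_actionI)
    show "tr y F \<in> X" if "y \<in> carrier P" "F \<in> X" for y F
      using that conj_inv_closed by (auto simp: X_def tr_D)
    show "tr \<one> F = F" if "F \<in> X" for F
      using that by (auto simp: X_def tr_D B_carrier)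
    show "tr (y \<otimes> z) F = tr y (tr z F)"
      if yz: "y \<in> carrier P" "z \<in> carrier P" "F \<in> X" for y z F
    proof -
      obtain c where c: "c \<in> B" "F = D c" using yz(3) by (auto simp: X_def)
      have "tr y (tr z F) = D (y \<otimes> (z \<otimes> c \<otimes> inv z) \<otimes> inv y)"
        using yz c tr_D conj_inv_closed by simp
      also have "y \<otimes> (z \<otimes> c \<otimes> inv z) \<otimes> inv y = (y \<otimes> z) \<otimes> c \<otimes> inv (y \<otimes> z)"
        using yz c B_carrier by (simp add: inv_mult_group m_assoc)
      finally show ?thesis using yz c tr_D by simp
    qed
  qed
  have X1: "D \<one> \<in> X" using subgroup.one_closed[OF B] by (simp add: X_def)
  have fix1: "(\<lambda>F\<in>X. tr y F) (D \<one>) = D \<one>" if "y \<in> carrier P" for y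
    using that X1 tr_D[of y \<one>] subgroup.one_closed[OF B] by simp
  obtain F where F: "F \<in> X" "F \<noteq> D \<one>" "\<And>y. y \<in> carrier P \<Longrightarrow> (\<lambda>F\<in>X. tr y F) F = F"
    using group_action.exists_second_fixed_point[OF act prime ord_P _ pX X1 fix1] finB
    unfolding X_def by blast
  then obtain m where m: "m \<in> B" "F = D m" by (auto simp: X_def)
  define \<xi> where "\<xi> g = D m g \<one>" for g
  have \<xi>: "pr m (g \<otimes> x) = \<xi> g * pr m x" if "g \<in> C" "x \<in> carrier P" for g x
  proof -
    \<comment> \<open>Invariance under translation by \<open>x\<close> carries the value at
      \<open>x\<close> to the value at the identity, so the quotient depends on \<open>g\<close>
      alone.\<close>
    have "D m g x = tr x (D m) g x" using F(1,3) m that(2) by simp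
    also have "\<dots> = \<xi> g" using that by (simp add: tr_def \<xi>_def)
    finally have "D m g x = \<xi> g" .
    then show ?thesis using that m by (simp add: D_def pr_nonzero divide_eq_eq)
  qed
  have "\<exists>g\<in>C. \<xi> g \<noteq> 1"
  proof (rule ccontr)
    assume "\<not> ?thesis"
    then have "D m = D \<one>"
      using \<xi> m CP by (auto simp: D_def fun_eq_iff pr_one pr_nonzero)
    then show False using F m by simp
  qed
  have ex: "\<forall>g\<in>C. \<xi> g ^ (p ^ k) = 1"
  proof
    fix g assume g: "g \<in> C"
    have "\<xi> g = pr m g / pr m \<one>" using g CP by (simp add: \<xi>_def D_def)
    then show "\<xi> g ^ (p ^ k) = 1" using m(1) CP[OF g] by (simp add: power_divide pr_power_order)
  qed
  \<comment> \<open>\<open>p ^ t\<close> is the least power of \<open>p\<close> killing all values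
    of \<open>\<xi>\<close>. Raising \<open>m\<close> to the power \<open>p ^ (t - 1)\<close> leaves
    a nontrivial factor with values among the \<open>p\<close>-th roots of unity.\<close>
  define t where "t = (LEAST t. \<forall>g\<in>C. \<xi> g ^ (p ^ t) = 1)"
  have t: "\<forall>g\<in>C. \<xi> g ^ (p ^ t) = 1"
    unfolding t_def by (rule LeastI[of _ k]) (rule ex)
  then obtain s where s: "t = Suc s" using \<open>\<exists>g\<in>C. \<xi> g \<noteq> 1\<close> by (cases t) auto
  have ns: "\<exists>g\<in>C. \<xi> g ^ (p ^ s) \<noteq> 1"
    using not_less_Least[of s "\<lambda>t. \<forall>g\<in>C. \<xi> g ^ (p ^ t) = 1"] s t_def by auto
  show thesis
  proof (rule that[of "m [^] (p ^ s)" "\<lambda>g. \<xi> g ^ (p ^ s)"])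
    show "m [^] (p ^ s) \<in> B" using m by (simp add: B_pow)
    show "pr (m [^] (p ^ s)) (g \<otimes> x) = \<xi> g ^ (p ^ s) * pr (m [^] (p ^ s)) x"
      if "g \<in> C" "x \<in> carrier P" for g x
      using that m CP by (simp add: pr_pow \<xi> power_mult_distrib)
    show "(\<xi> g ^ (p ^ s)) ^ p = 1" if "g \<in> C" for g
      using t that s by (simp add: power_mult[symmetric] mult.commute)
  qed (rule ns)
qed

section \<open>Burnside weights and the descent from P to B\<close>

definition weight :: "'a set \<Rightarrow> 'a \<Rightarrow> nat" where
  "weight C b = (if b \<in> live C then card (stab C b) else 0)"

text \<open>Multiplied by \<open>card D\<close>, the sum over \<open>C\<close> splits into sums over
  \<open>D\<close> based at the points \<open>c \<otimes> x\<close>; if all of these vanish, so does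
  the sum over \<open>C\<close>.\<close>

lemma live_subgroup:
  assumes C: "subgroup C P" and D: "subgroup D P" "D \<subseteq> C" and b: "b \<in> live C"
  shows "b \<in> live D"
proof (rule ccontr)
  assume nl: "b \<notin> live D"
  note CP = subgroup.mem_carrier[OF C]
  obtain x where x: "b \<in> B" "x \<in> carrier P" "(\<Sum>c\<in>C. pr b (c \<otimes> x)) \<noteq> 0"
    using b by (auto simp: live_def)
  have "of_nat (card D) * (\<Sum>c\<in>C. pr b (c \<otimes> x)) = (\<Sum>d\<in>D. \<Sum>c\<in>C. pr b (d \<otimes> c \<otimes> x))"
    using sum_translate[OF C, of _ "\<lambda>c. pr b (c \<otimes> x)"] D(2) by (simp add: subset_iff)
  also have "\<dots> = (\<Sum>c\<in>C. \<Sum>d\<in>D. pr b (d \<otimes> (c \<otimes> x)))"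
    using CP x D(2) by (subst sum.swap) (auto intro!: sum.cong simp: m_assoc subset_iff)
  also have "\<dots> = 0"
  proof (rule sum.neutral, rule)
    fix c assume "c \<in> C"
    then have "c \<otimes> x \<in> carrier P" using CP x by simp
    then show "(\<Sum>d\<in>D. pr b (d \<otimes> (c \<otimes> x))) = 0" using nl x(1) by (auto simp: live_def)
  qed
  finally have "card D = 0" using x by simp
  then show False
    using finite_subgroup[OF D(1)] subgroup.one_closed[OF D(1)] by auto
qed

text \<open>Translation by \<open>g\<close> permutes the summands and multiplies the sum by
  \<open>\<eta>\<close>.\<close>

lemma not_liveI:
  assumes C: "subgroup C P" and g: "g \<in> C" and b: "b \<in> B"
    and eq: "\<And>x. x \<in> carrier P \<Longrightarrow> pr b (g \<otimes> x) = \<eta> * pr b x" and "\<eta> \<noteq> 1"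
  shows "b \<notin> live C"
proof -
  note CP = subgroup.mem_carrier[OF C]
  have "(\<Sum>c\<in>C. pr b (c \<otimes> x)) = 0" if x: "x \<in> carrier P" for x
  proof -
    have "(\<Sum>c\<in>C. pr b (c \<otimes> x)) = (\<Sum>c\<in>C. pr b (g \<otimes> c \<otimes> x))"
      using sum_translate[OF C g, of "\<lambda>c. pr b (c \<otimes> x)"] by simp
    also have "\<dots> = (\<Sum>c\<in>C. \<eta> * pr b (c \<otimes> x))"
      using eq CP g x by (intro sum.cong) (auto simp: m_assoc)
    also have "\<dots> = \<eta> * (\<Sum>c\<in>C. pr b (c \<otimes> x))" by (simp add: sum_distrib_left)
    finally show ?thesis using \<open>\<eta> \<noteq> 1\<close> by (metis mult_cancel_right1)
  qed
  then show ?thesis by (auto simp: live_def)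
qed

lemma sum_translate_B:
  assumes "n \<in> B"
  shows "(\<Sum>b\<in>B. f (b \<otimes> n)) = (\<Sum>b\<in>B. f b)"
  using sum_translate_right[OF B assms] .

text \<open>If \<open>b n\<^sup>i\<close> is stabilized by some \<open>g\<close> with \<open>\<zeta> g \<noteq> 1\<close>, then \<open>g\<close> multiplies the sum over \<open>C\<close> at
  every other \<open>b n\<^sup>j\<close> by a factor different from \<open>1\<close>: at most one of the \<open>p\<close> terms survives,
  and its stabilizer grows by a factor of at most \<open>p\<close>.\<close>

lemma weight_step:
  assumes C: "subgroup C P" and BC: "B \<subset> C"
  obtains D where "subgroup D P" "B \<subseteq> D" "D \<subset> C" "(\<Sum>b\<in>B. weight C b) \<le> (\<Sum>b\<in>B. weight D b)"
proof -
  note CP = subgroup.mem_carrier[OF C]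
  note pgt = prime_gt_0_nat[OF prime]
  obtain n \<zeta> where n: "n \<in> B"
    and \<zeta>: "\<And>g x. g \<in> C \<Longrightarrow> x \<in> carrier P \<Longrightarrow> pr n (g \<otimes> x) = \<zeta> g * pr n x"
    and \<zeta>p: "\<And>g. g \<in> C \<Longrightarrow> \<zeta> g ^ p = 1" and ex: "\<exists>g\<in>C. \<zeta> g \<noteq> 1"
    using exists_semi_invariant[OF C BC] by metis
  have \<zeta>_eq: "\<zeta> g = pr n g / pr n \<one>" if "g \<in> C" for g
    using \<zeta>[OF that one_closed] that n CP by (simp add: pr_nonzero)
  have \<zeta>_mult: "\<zeta> (g \<otimes> h) = \<zeta> g * \<zeta> h" if "g \<in> C" "h \<in> C" for g h
  proof -
    have "\<zeta> (g \<otimes> h) * pr n \<one> = pr n (g \<otimes> h)"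
      using \<zeta>_eq[of "g \<otimes> h"] subgroup.m_closed[OF C that] n by (simp add: pr_nonzero)
    also have "\<dots> = \<zeta> g * (\<zeta> h * pr n \<one>)"
      using \<zeta>[of g h] \<zeta>[of h \<one>] that CP by simp
    finally show ?thesis using n by (simp add: pr_nonzero)
  qed
  have \<zeta>_nz: "\<zeta> g \<noteq> 0" if "g \<in> C" for g
    using \<zeta>_eq[OF that] n CP that by (simp add: pr_nonzero)
  have \<zeta>_inv: "\<zeta> (inv g) = inverse (\<zeta> g)" if "g \<in> C" for g
  proof -
    have "\<zeta> g * \<zeta> (inv g) = \<zeta> \<one>"
      using \<zeta>_mult[of g "inv g"] that subgroup.m_inv_closed[OF C] CP by simp
    also have "\<zeta> \<one> = 1"
      using \<zeta>_eq[OF subgroup.one_closed[OF C]] n by (simp add: pr_nonzero)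
    finally show ?thesis by (metis inverse_unique)
  qed
  \<comment> \<open>The kernel of the homomorphism \<open>\<zeta>\<close> from \<open>C\<close> to
    the \<open>p\<close>-th roots of unity, proper because \<open>\<zeta>\<close> is not trivial on
    \<open>C\<close>.\<close>
  define D where "D = {g \<in> C. \<zeta> g = 1}"
  have D: "subgroup D P"
  proof (rule subgroupI)
    show "D \<subseteq> carrier P" using CP by (auto simp: D_def)
    show "D \<noteq> {}"
      using \<zeta>_eq[OF subgroup.one_closed[OF C]] n subgroup.one_closed[OF C]
      by (auto simp: D_def pr_nonzero)
    show "inv g \<in> D" if "g \<in> D" for g
      using that \<zeta>_inv subgroup.m_inv_closed[OF C] by (simp add: D_def)
    show "g \<otimes> h \<in> D" if "g \<in> D" "h \<in> D" for g h
      using that \<zeta>_mult subgroup.m_closed[OF C] by (simp add: D_def)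
  qed
  have DC: "D \<subset> C" using ex by (auto simp: D_def)
  have BD: "B \<subseteq> D"
  proof
    fix g assume g: "g \<in> B"
    then have gC: "g \<in> C" using BC by blast
    have "pr n (g \<otimes> \<one>) = pr n \<one>"
      using inertia[OF B_carrier[OF g]] g n one_closed by blast
    then show "g \<in> D"
      using gC \<zeta>_eq[OF gC] n CP by (simp add: D_def pr_nonzero)
  qed
  have npow: "n [^] i \<in> B" for i :: nat using n by (rule B_pow)
  have bn: "b \<otimes> n [^] i \<in> B" if "b \<in> B" for b and i :: nat
    using subgroup.m_closed[OF B that npow] .
  have pr_bn: "pr (b \<otimes> n [^] i) x = pr b x * pr n x ^ i"
    if "b \<in> B" "x \<in> carrier P" for b x and i :: nat
    using that npow n by (simp add: pr_mult pr_pow)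
  \<comment> \<open>\<open>pr n\<close> is invariant under \<open>D\<close>, so a factor
    \<open>n [^] i\<close> changes neither the stabilizer in \<open>D\<close> nor, below, liveness
    for \<open>D\<close>.\<close>
  have stabD_bn: "stab D (b \<otimes> n [^] i) = stab D b" if b: "b \<in> B" for b and i :: nat
  proof -
    have "pr (b \<otimes> n [^] i) (g \<otimes> x) = pr (b \<otimes> n [^] i) x \<longleftrightarrow> pr b (g \<otimes> x) = pr b x"
      if "g \<in> D" "x \<in> carrier P" for g x
      using that b \<zeta>[of g x] CP n by (simp add: pr_bn D_def pr_nonzero)
    then show ?thesis by (auto simp: stab_def)
  qed
  have liveD_bn: "b \<otimes> n [^] i \<in> live D \<longleftrightarrow> b \<in> live D" if b: "b \<in> B" for b and i :: nat
  proof -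
    have "(\<Sum>c\<in>D. pr (b \<otimes> n [^] i) (c \<otimes> x)) = (\<Sum>c\<in>D. pr b (c \<otimes> x)) * pr n x ^ i"
      if x: "x \<in> carrier P" for x
    proof -
      have "(\<Sum>c\<in>D. pr (b \<otimes> n [^] i) (c \<otimes> x)) = (\<Sum>c\<in>D. pr b (c \<otimes> x) * pr n x ^ i)"
        using x b CP by (intro sum.cong) (auto simp: pr_bn D_def \<zeta>)
      then show ?thesis by (simp add: sum_distrib_right)
    qed
    then show ?thesis using b bn n by (simp add: live_def pr_nonzero)
  qed
  have weightD_bn: "weight D (b \<otimes> n [^] i) = weight D b" if "b \<in> B" for b and i :: nat
    using that by (simp add: weight_def liveD_bn stabD_bn)
  have fib: "card (stab C b) \<le> p * card (stab D b)" if b: "b \<in> B" for b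
  proof -
    have sub: "subgroup (stab C b) P" using stab_subgroup[OF C b] .
    \<comment> \<open>The fibres of \<open>\<zeta>\<close> on \<open>stab C b\<close> are the cosets
      of \<open>stab D b\<close>, and there are at most \<open>p\<close> values.\<close>
    have "card (stab C b) = card (\<zeta> ` stab C b) * card (stab D b)"
    proof (rule card_eq_card_image_mult[OF sub finite_subgroup[OF sub]])
      show "stab D b \<subseteq> stab C b" by (auto simp: stab_def D_def)
      fix g h assume gh: "g \<in> stab C b" "h \<in> stab C b"
      then have gC: "g \<in> C" "h \<in> C" by (auto simp: stab_def)
      have "inv g \<otimes> h \<in> stab C b"
        using gh subgroup.m_closed[OF sub] subgroup.m_inv_closed[OF sub] by simp
      moreover have "\<zeta> (inv g \<otimes> h) = \<zeta> h / \<zeta> g"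
        using gC subgroup.m_inv_closed[OF C] by (simp add: \<zeta>_mult \<zeta>_inv field_simps)
      ultimately show "\<zeta> g = \<zeta> h \<longleftrightarrow> inv g \<otimes> h \<in> stab D b"
        using \<zeta>_nz[OF gC(1)] by (auto simp: stab_def D_def)
    qed
    moreover have "card (\<zeta> ` stab C b) \<le> p"
    proof -
      have "\<zeta> ` stab C b \<subseteq> {z. z ^ p = 1}" using \<zeta>p by (auto simp: stab_def)
      moreover have "finite {z::complex. z ^ p = 1}" "card {z::complex. z ^ p = 1} = p"
        using card_roots_unity_eq[OF pgt] pgt by (auto intro: card_ge_0_finite)
      ultimately show ?thesis by (metis card_mono)
    qed
    ultimately show ?thesis by simp
  qed
  have weight_le: "weight C b \<le> p * weight D b" if b: "b \<in> B" for b
    using fib[OF b] live_subgroup[OF C D psubset_imp_subset[OF DC]] by (simp add: weight_def)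
  have main: "(\<Sum>i<p. weight C (b \<otimes> n [^] i)) \<le> p * weight D b" if b: "b \<in> B" for b
  proof (cases "\<exists>i<p. \<not> stab C (b \<otimes> n [^] i) \<subseteq> D")
    case True
    then obtain i g where i: "i < p" and g: "g \<in> stab C (b \<otimes> n [^] i)" "g \<notin> D" by blast
    then have gC: "g \<in> C" "\<zeta> g \<noteq> 1" by (auto simp: stab_def D_def)
    have zero: "weight C (b \<otimes> n [^] j) = 0" if j: "j < p" "j \<noteq> i" for j
    proof -
      have "\<zeta> g ^ j \<noteq> \<zeta> g ^ i"
      proof
        assume eq: "\<zeta> g ^ j = \<zeta> g ^ i"
        \<comment> \<open>The powers of a nontrivial \<open>p\<close>-th root of unity with
          exponents below \<open>p\<close> are distinct: Bezout inverts \<open>c - a\<close> modulo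
          \<open>p\<close>.\<close>
        have *: False if ab: "a < c" "c < p" "\<zeta> g ^ a = \<zeta> g ^ c" for a c :: nat
        proof -
          have "\<zeta> g ^ (c - a) = 1"
            using ab \<zeta>_nz[OF gC(1)] by (simp add: power_diff)
          moreover have "coprime (c - a) p"
            using prime ab by (metis coprime_commute diff_is_0_eq' linorder_not_less nat_dvd_not_less prime_imp_coprime less_imp_diff_less zero_less_diff)
          then obtain u v where "(c - a) * u = p * v + 1"
            using bezout_nat[of "c - a" p] ab by auto
          ultimately have "\<zeta> g ^ (p * v + 1) = 1" by (metis power_mult power_one)
          then show False using \<zeta>p[OF gC(1)] gC(2) by (simp add: power_add power_mult)
        qed
        show False using *[of i j] *[of j i] eq i j by (metis linorder_neqE_nat)
      qed
      then have ne: "\<zeta> g ^ j / \<zeta> g ^ i \<noteq> 1" using \<zeta>_nz[OF gC(1)] by simp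
      have "b \<otimes> n [^] j \<notin> live C"
      proof (rule not_liveI[OF C gC(1) bn[OF b] _ ne])
        fix x assume x: "x \<in> carrier P"
        have "pr b (g \<otimes> x) * (\<zeta> g ^ i * pr n x ^ i) = pr b x * pr n x ^ i"
          using stabD[OF g(1) x] b x gC CP by (simp add: pr_bn \<zeta> power_mult_distrib)
        then have "pr b (g \<otimes> x) * \<zeta> g ^ i = pr b x"
          using x n by (simp add: pr_nonzero)
        then have "pr b (g \<otimes> x) = pr b x / \<zeta> g ^ i"
          using \<zeta>_nz[OF gC(1)] by (simp add: eq_divide_eq)
        then show "pr (b \<otimes> n [^] j) (g \<otimes> x) = \<zeta> g ^ j / \<zeta> g ^ i * pr (b \<otimes> n [^] j) x"
          using b x gC CP by (simp add: pr_bn \<zeta> power_mult_distrib)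
      qed
      then show ?thesis by (simp add: weight_def)
    qed
    have "(\<Sum>j<p. weight C (b \<otimes> n [^] j)) = weight C (b \<otimes> n [^] i) + (\<Sum>j\<in>{..<p} - {i}. weight C (b \<otimes> n [^] j))"
      using i by (simp add: sum.remove)
    also have "\<dots> = weight C (b \<otimes> n [^] i)" using zero by (simp add: sum.neutral)
    also have "\<dots> \<le> p * weight D (b \<otimes> n [^] i)" using weight_le[OF bn[OF b]] .
    finally show ?thesis using weightD_bn[OF b] by simp
  next
    case False
    \<comment> \<open>Here all \<open>p\<close> stabilizers lie in \<open>D\<close>, and live
      elements for \<open>C\<close> are live for \<open>D\<close>; so each weight is bounded by the
      common weight over \<open>D\<close>.\<close>
    have "weight C (b \<otimes> n [^] i) \<le> weight D b" if i: "i < p" for i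
    proof -
      have "stab C (b \<otimes> n [^] i) = stab D (b \<otimes> n [^] i)"
        using False i DC by (fastforce simp: stab_def)
      then have "weight C (b \<otimes> n [^] i) \<le> weight D (b \<otimes> n [^] i)"
        using live_subgroup[OF C D psubset_imp_subset[OF DC]] by (simp add: weight_def)
      then show ?thesis using weightD_bn[OF b] by simp
    qed
    then have "(\<Sum>i<p. weight C (b \<otimes> n [^] i)) \<le> (\<Sum>i<p. weight D b)" by (intro sum_mono) simp
    then show ?thesis by simp
  qed
  \<comment> \<open>Translation by a power of \<open>n\<close> permutes \<open>B\<close>, so
    \<open>p\<close> copies of the sum can be spread over the \<open>p\<close> translates and
    \<open>main\<close> applied at each \<open>b\<close>.\<close>
  have "p * (\<Sum>b\<in>B. weight C b) = (\<Sum>i<p. \<Sum>b\<in>B. weight C (b \<otimes> n [^] i))"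
    using sum_translate_B[OF npow, of "weight C"] by simp
  also have "\<dots> = (\<Sum>b\<in>B. \<Sum>i<p. weight C (b \<otimes> n [^] i))" by (rule sum.swap)
  also have "\<dots> \<le> (\<Sum>b\<in>B. p * weight D b)" using main by (rule sum_mono)
  finally have "(\<Sum>b\<in>B. weight C b) \<le> (\<Sum>b\<in>B. weight D b)"
    using pgt by (simp add: sum_distrib_left[symmetric])
  then show thesis using that D BD DC by blast
qed

text \<open>The descent ends at \<open>C = B\<close>, where each of the \<open>card B\<close>
  weights is at most \<open>card B\<close>.\<close>

lemma sum_weight_le:
  assumes "subgroup C P" "B \<subseteq> C"
  shows "(\<Sum>b\<in>B. weight C b) \<le> card B ^ 2"
  using assms
proof (induction "card C" arbitrary: C rule: less_induct)
  case less
  show ?case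
  proof (cases "C = B")
    case True
    have "weight C b \<le> card B" for b
      using True card_mono[OF finB, of "stab C b"] by (auto simp: weight_def stab_def)
    then have "(\<Sum>b\<in>B. weight C b) \<le> (\<Sum>b\<in>B. card B)" by (intro sum_mono) simp
    then show ?thesis by (simp add: power2_eq_square)
  next
    case False
    then have "B \<subset> C" using less.prems by blast
    then obtain D where D: "subgroup D P" "B \<subseteq> D" "D \<subset> C"
      "(\<Sum>b\<in>B. weight C b) \<le> (\<Sum>b\<in>B. weight D b)"
      using weight_step[OF less.prems(1)] by blast
    have "card D < card C" using D(3) finite_subgroup[OF less.prems(1)] by (rule psubset_card_mono[rotated])
    then show ?thesis using less.hyps D by (meson le_trans)
  qed
qed

text \<open>A centralizer lies in the stabilizer modulo the kernel, and a nonzero sum makes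
  \<open>b\<close> live for the whole group; so the weights over \<open>carrier P\<close> dominate
  the terms.\<close>

lemma sum_centralizers_le:
  "(\<Sum>b\<in>{b\<in>B. (\<Sum>x\<in>carrier P. pr b x) \<noteq> 0}. card {g\<in>carrier P. g \<otimes> b \<otimes> inv g = b}) \<le> card B ^ 2"
proof -
  let ?S = "{b\<in>B. (\<Sum>x\<in>carrier P. pr b x) \<noteq> 0}"
  have "card {g\<in>carrier P. g \<otimes> b \<otimes> inv g = b} \<le> weight (carrier P) b" if b: "b \<in> ?S" for b
  proof -
    have "(\<Sum>c\<in>carrier P. pr b (c \<otimes> \<one>)) = (\<Sum>c\<in>carrier P. pr b c)" by (rule sum.cong) auto
    then have "b \<in> live (carrier P)" using b one_closed unfolding live_def by force
    moreover have "{g\<in>carrier P. g \<otimes> b \<otimes> inv g = b} \<subseteq> stab (carrier P) b"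
    proof
      fix g assume "g \<in> {g\<in>carrier P. g \<otimes> b \<otimes> inv g = b}"
      then have g: "g \<in> carrier P" "g \<otimes> b \<otimes> inv g = b" by auto
      have "inv g \<otimes> b \<otimes> g = inv g \<otimes> (g \<otimes> b \<otimes> inv g) \<otimes> g" using g by simp
      also have "\<dots> = b" using g(1) b B_carrier[of b] by (simp add: m_assoc inv_solve_left')
      finally have "inv g \<otimes> b \<otimes> g = b" .
      then show "g \<in> stab (carrier P) b" using pr_conj[OF g(1), of _ b] b g(1) by (simp add: stab_def)
    qed
    moreover have "finite (stab (carrier P) b)" using fin by (simp add: stab_def)
    ultimately show ?thesis by (simp add: weight_def card_mono)
  qed
  then have "(\<Sum>b\<in>?S. card {g\<in>carrier P. g \<otimes> b \<otimes> inv g = b}) \<le> (\<Sum>b\<in>?S. weight (carrier P) b)"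
    by (rule sum_mono)
  also have "\<dots> \<le> (\<Sum>b\<in>B. weight (carrier P) b)" using finB by (intro sum_mono2) auto
  also have "\<dots> \<le> card B ^ 2"
    using sum_weight_le[OF subgroup_self subgroup.subset[OF B]] .
  finally show ?thesis .
qed

section \<open>Orthogonality among the conjugates of \<mu>\<close>

lemma sum_pr_cnj:
  assumes g: "g \<in> carrier P" and h: "h \<in> carrier P"
  shows "(\<Sum>b\<in>B. pr b g * cnj (pr b h)) = (if g \<otimes> inv h \<in> B then of_nat (card B) else 0)"
proof -
  define c where "c = g \<otimes> inv h"
  have c: "c \<in> carrier P" "g = c \<otimes> h" using g h by (simp_all add: c_def m_assoc)
  have unit: "pr b x * cnj (pr b x) = 1" if "b \<in> B" "x \<in> carrier P" for b x
    using norm_pr[OF that] by (simp add: complex_norm_square[symmetric])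
  show ?thesis
  proof (cases "c \<in> B")
    case True
    have "pr b g = pr b h" if "b \<in> B" for b
      using True inertia[OF c(1)] that h c(2) by blast
    then have "(\<Sum>b\<in>B. pr b g * cnj (pr b h)) = (\<Sum>b\<in>B. 1)"
      using unit h by (intro sum.cong) auto
    then show ?thesis using True by (simp add: c_def)
  next
    case False
    then obtain b x where b: "b \<in> B" "x \<in> carrier P" "pr b (c \<otimes> x) \<noteq> pr b x"
      using inertia[OF c(1)] by blast
    \<comment> \<open>\<open>inertia\<close> separates the two characters at some base point
      \<open>x\<close>. Conjugating \<open>b\<close> by \<open>y\<close> moves this point to
      \<open>h\<close>, and \<open>pr_commute\<close> lets \<open>y\<close> pass
      \<open>c\<close>.\<close>
    define y where "y = x \<otimes> inv h"
    have y: "y \<in> carrier P" "x = y \<otimes> h" using b h by (simp_all add: y_def m_assoc)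
    define d where "d = inv y \<otimes> b \<otimes> y"
    have d: "d \<in> B" using y b conj_closed by (simp add: d_def)
    have "pr d g = pr b (c \<otimes> x)"
      using pr_conj[of y g b] pr_commute[of y c h b] c y b g h by (simp add: d_def)
    moreover have "pr d h = pr b x" using pr_conj[of y h b] y b h by (simp add: d_def)
    ultimately have ne: "pr d g \<noteq> pr d h" using b by simp
    have ne1: "pr d g * cnj (pr d h) \<noteq> 1"
    proof
      assume "pr d g * cnj (pr d h) = 1"
      then have "pr d h = pr d g * (pr d h * cnj (pr d h))" by (simp add: mult.commute mult.left_commute)
      then show False using ne unit[OF d h] by simp
    qed
    let ?S = "\<Sum>b\<in>B. pr b g * cnj (pr b h)"
    have "?S = (\<Sum>b\<in>B. pr (b \<otimes> d) g * cnj (pr (b \<otimes> d) h))"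
      using sum_translate_B[OF d, of "\<lambda>b. pr b g * cnj (pr b h)"] by simp
    also have "\<dots> = (\<Sum>b\<in>B. pr b g * cnj (pr b h) * (pr d g * cnj (pr d h)))"
      using d g h by (intro sum.cong) (auto simp: pr_mult)
    also have "\<dots> = ?S * (pr d g * cnj (pr d h))" by (simp add: sum_distrib_right)
    finally have "?S = 0" using ne1 mult_cancel_left1[of ?S "pr d g * cnj (pr d h)"] by blast
    then show ?thesis using False by (simp add: c_def)
  qed
qed

text \<open>The distinct characters \<open>pr _ g\<close> (\<open>g \<in> S\<close>) of \<open>B\<close> agree on the subgroup \<open>T\<close>; comparing the
  \<open>L\<^sup>2\<close> norm of their sum over \<open>B\<close> with its values on \<open>T\<close> bounds their number by the index of \<open>T\<close>.\<close>

lemma card_stab_mult_le: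
  assumes S: "subgroup S P" "B \<subseteq> S" and T: "T \<subseteq> B"
    and inv: "\<And>b g. b \<in> T \<Longrightarrow> g \<in> S \<Longrightarrow> pr b g = pr b \<one>"
  shows "card S * card T \<le> card B ^ 2"
proof -
  note SP = subgroup.mem_carrier[OF S(1)]
  define F where "F b = (\<Sum>g\<in>S. pr b g)" for b
  have "complex_of_real (\<Sum>b\<in>B. (norm (F b))^2) = (\<Sum>b\<in>B. F b * cnj (F b))"
    by (simp add: complex_norm_square del: of_real_power)
  also have "\<dots> = (\<Sum>b\<in>B. \<Sum>g\<in>S. \<Sum>h\<in>S. pr b g * cnj (pr b h))"
    by (simp add: F_def cnj_sum sum_product)
  also have "\<dots> = (\<Sum>g\<in>S. \<Sum>b\<in>B. \<Sum>h\<in>S. pr b g * cnj (pr b h))" by (rule sum.swap)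
  also have "\<dots> = (\<Sum>g\<in>S. \<Sum>h\<in>S. \<Sum>b\<in>B. pr b g * cnj (pr b h))"
    by (rule sum.cong[OF refl], rule sum.swap)
  also have "\<dots> = (\<Sum>g\<in>S. of_nat (card B) * of_nat (card B))"
  proof (rule sum.cong)
    fix g assume g: "g \<in> S"
    have "(\<Sum>h\<in>S. \<Sum>b\<in>B. pr b g * cnj (pr b h)) = (\<Sum>h\<in>S. if g \<otimes> inv h \<in> B then of_nat (card B) else 0)"
      using sum_pr_cnj SP g by (intro sum.cong) auto
    also have "\<dots> = (\<Sum>h\<in>{h\<in>S. g \<otimes> inv h \<in> B}. of_nat (card B))"
      using finite_subgroup[OF S(1)] by (simp add: sum.If_cases Int_def conj_commute)
    also have "\<dots> = of_nat (card {h\<in>S. g \<otimes> inv h \<in> B}) * of_nat (card B)" by simp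
    \<comment> \<open>These \<open>h\<close> form the coset of \<open>B\<close> through
      \<open>g\<close>, which lies in \<open>S\<close>.\<close>
    also have "card {h\<in>S. g \<otimes> inv h \<in> B} = card B"
    proof (rule bij_betw_same_card[of "\<lambda>h. g \<otimes> inv h"], rule bij_betw_byWitness[where f' = "\<lambda>b. inv b \<otimes> g"])
      show "\<forall>h\<in>{h \<in> S. g \<otimes> inv h \<in> B}. inv (g \<otimes> inv h) \<otimes> g = h"
        using SP g by (auto simp: inv_mult_group m_assoc)
      show "\<forall>b\<in>B. g \<otimes> inv (inv b \<otimes> g) = b"
        using SP[OF g] B_carrier by (auto simp: inv_mult_group m_assoc[symmetric])
      show "(\<lambda>h. g \<otimes> inv h) ` {h \<in> S. g \<otimes> inv h \<in> B} \<subseteq> B" by auto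
      show "(\<lambda>b. inv b \<otimes> g) ` B \<subseteq> {h \<in> S. g \<otimes> inv h \<in> B}"
        using SP[OF g] B_carrier g S(2) subgroup.m_closed[OF S(1)] subgroup.m_inv_closed[OF S(1)]
        by (auto simp: inv_mult_group m_assoc[symmetric] subset_iff)
    qed
    finally show "(\<Sum>h\<in>S. \<Sum>b\<in>B. pr b g * cnj (pr b h)) = of_nat (card B) * of_nat (card B)" .
  qed simp
  finally have "complex_of_real (\<Sum>b\<in>B. (norm (F b))^2) = of_real (real (card S) * real (card B)^2)"
    by (simp add: power2_eq_square)
  then have total: "(\<Sum>b\<in>B. (norm (F b))^2) = real (card S) * real (card B)^2"
    using of_real_eq_iff by blast
  \<comment> \<open>On \<open>T\<close> all summands of \<open>F b\<close> agree, and each has norm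
    1.\<close>
  have "norm (F b) = card S" if b: "b \<in> T" for b
  proof -
    have "F b = of_nat (card S) * pr b \<one>" using inv[OF b] by (simp add: F_def)
    then show ?thesis using norm_pr[of b \<one>] b T by (auto simp: norm_mult)
  qed
  then have "real (card T) * real (card S)^2 = (\<Sum>b\<in>T. (norm (F b))^2)" by simp
  also have "\<dots> \<le> (\<Sum>b\<in>B. (norm (F b))^2)" using finB T by (intro sum_mono2) auto
  finally have "real (card S) * (real (card S) * real (card T)) \<le> real (card S) * real (card B)^2"
    using total by (simp add: power2_eq_square mult_ac)
  moreover have "card S > 0"
    using finite_subgroup[OF S(1)] subgroup.one_closed[OF S(1)] by (auto simp: card_gt_0_iff)
  ultimately have "real (card S) * real (card T) \<le> real (card B)^2" by simp
  then have "real (card S * card T) \<le> real (card B ^ 2)" by simp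
  then show ?thesis by (simp only: of_nat_le_iff)
qed

section \<open>Counting modulo the kernel of \<chi>, and the order bound\<close>

definition vals :: "'a \<Rightarrow> 'a \<Rightarrow> complex" where
  "vals b = restrict (pr b) (carrier P)"

lemma vals_eq_iff: "vals b = vals c \<longleftrightarrow> (\<forall>x\<in>carrier P. pr b x = pr c x)"
  unfolding vals_def restrict_def fun_eq_iff by auto

text \<open>\<open>vals\<close> restricts to the carrier, so equality of the functions is equality
  modulo the kernel of \<chi>; its fibres on \<open>L\<close> are the cosets of that kernel.\<close>

lemma card_eq_card_vals_mult:
  assumes L: "subgroup L P" "L \<subseteq> B" and K: "{b\<in>B. \<forall>x\<in>carrier P. pr b x = 1} \<subseteq> L"
  shows "card L = card (vals ` L) * card {b\<in>B. \<forall>x\<in>carrier P. pr b x = 1}"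
proof (rule card_eq_card_image_mult[OF L(1) finite_subgroup[OF L(1)] K])
  fix b c assume bc: "b \<in> L" "c \<in> L"
  then have BB: "b \<in> B" "c \<in> B" using L by auto
  have m: "inv b \<otimes> c \<in> B" using BB B by (simp add: subgroup.m_closed subgroup.m_inv_closed)
  have "pr (inv b \<otimes> c) x = 1 \<longleftrightarrow> pr b x = pr c x" if x: "x \<in> carrier P" for x
  proof -
    have "pr (inv b \<otimes> c) x = pr c x / pr b x"
      using BB x subgroup.m_inv_closed[OF B] by (simp add: pr_mult pr_inv divide_inverse mult.commute)
    then show ?thesis using pr_nonzero[OF BB(1) x] by auto
  qed
  then show "vals b = vals c \<longleftrightarrow> inv b \<otimes> c \<in> {b\<in>B. \<forall>x\<in>carrier P. pr b x = 1}"
    using m by (auto simp: vals_eq_iff)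
qed

text \<open>The exponent \<open>a\<close> serves to treat \<open>f\<close> and its power
  \<open>f [^] (p ^ (e - 1))\<close> alike in the proof of the order bound.\<close>

lemma pr_pow_translate:
  assumes g: "g \<in> carrier P" and f: "f \<in> B"
    and eq: "\<And>x. x \<in> carrier P \<Longrightarrow> pr f (g \<otimes> x) ^ a = (pr f x ^ a) ^ u" and x: "x \<in> carrier P"
  shows "pr f (g [^] (m::nat) \<otimes> x) ^ a = (pr f x ^ a) ^ (u ^ m)"
  using x
proof (induction m arbitrary: x)
  case (Suc m)
  have "pr f (g [^] Suc m \<otimes> x) ^ a = pr f (g [^] m \<otimes> (g \<otimes> x)) ^ a"
    using g Suc.prems by (simp add: m_assoc)
  also have "\<dots> = ((pr f x ^ a) ^ u) ^ (u ^ m)" using Suc.IH[of "g \<otimes> x"] g Suc.prems eq by simp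
  finally show ?case by (simp add: power_mult[symmetric] mult.assoc)
qed simp

text \<open>Since |P| = \<chi>(1) |B|, this is the bound (2), squared and cleared of
  denominators.\<close>

lemma order_mult_ord_le:
  assumes odd: "odd p" and f: "f \<in> B" and nz: "(\<Sum>x\<in>carrier P. pr f x) \<noteq> 0"
  shows "Coset.order P * ord f ^ 2 \<le> card B ^ 3"
proof -
  note pgt = prime_gt_0_nat[OF prime] and pgt1 = prime_gt_1_nat[OF prime]
  define S where "S = stab (carrier P) f"
  have S: "subgroup S P" "B \<subseteq> S"
    unfolding S_def using stab_subgroup[OF subgroup_self f] B_subset_stab[OF subgroup.subset[OF B] f] .
  note SP = subgroup.mem_carrier[OF S(1)]
  have S_inv: "pr f (g \<otimes> x) = pr f x" if "g \<in> S" "x \<in> carrier P" for g x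
    using that by (simp add: S_def stab_def)
  have S_eq: "g \<in> S \<longleftrightarrow> (\<forall>x\<in>carrier P. pr f (g \<otimes> x) = pr f x)" if "g \<in> carrier P" for g
    using that by (simp add: S_def stab_def)
  \<comment> \<open>\<open>K\<close> is the kernel of \<chi> and \<open>L\<close> the product of
    \<open>K\<close> with the cyclic group of \<open>f\<close>. Both \<open>T\<close> and
    \<open>L\<close> contain \<open>K\<close>, so they can be counted modulo
    \<open>K\<close>.\<close>
  define T where "T = {b \<in> B. \<forall>g\<in>S. \<forall>x\<in>carrier P. pr b (g \<otimes> x) = pr b x}"
  define L where "L = {b \<in> B. \<exists>i. \<forall>x\<in>carrier P. pr b x = pr f x ^ i}"
  define K where "K = {b \<in> B. \<forall>x\<in>carrier P. pr b x = 1}"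
  have TB: "T \<subseteq> B" and LB: "L \<subseteq> B" by (auto simp: T_def L_def)
  have T: "subgroup T P"
  proof (rule subgroupI)
    show "T \<subseteq> carrier P" using B_carrier by (auto simp: T_def)
    have "f \<in> T" using f S_inv by (simp add: T_def)
    then show "T \<noteq> {}" by blast
    show "inv b \<in> T" if "b \<in> T" for b
      using that SP subgroup.m_inv_closed[OF B] by (simp add: T_def pr_inv)
    show "b \<otimes> c \<in> T" if "b \<in> T" "c \<in> T" for b c
      using that SP subgroup.m_closed[OF B] by (simp add: T_def pr_mult)
  qed
  have T_pow: "b [^] m \<in> T" if "b \<in> T" for b and m :: nat
    by (induction m) (use that subgroup.one_closed[OF T] subgroup.m_closed[OF T] in simp_all)
  have L: "subgroup L P"
  proof (rule subgroupI)
    show "L \<subseteq> carrier P" using B_carrier by (auto simp: L_def)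
    have "\<forall>x\<in>carrier P. pr f x = pr f x ^ 1" by simp
    then show "L \<noteq> {}" using f unfolding L_def by blast
    show "inv b \<in> L" if "b \<in> L" for b
    proof -
      obtain i where i: "b \<in> B" "\<forall>x\<in>carrier P. pr b x = pr f x ^ i" using \<open>b \<in> L\<close> by (auto simp: L_def)
      \<comment> \<open>The values are \<open>p ^ k\<close>-th roots of unity, so their inverses are
        powers with natural exponents.\<close>
      have "pr (inv b) x = pr f x ^ (i * (p ^ k - 1))" if x: "x \<in> carrier P" for x
      proof -
        have "pr b x ^ (p ^ k - 1) * pr b x = 1"
          using pr_power_order[OF i(1) x] pgt by (metis Suc_diff_1 power_Suc2 zero_less_power)
        then have "inverse (pr b x) = pr b x ^ (p ^ k - 1)" by (metis inverse_unique mult.commute)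
        then show ?thesis using i x by (simp add: pr_inv power_mult)
      qed
      then show ?thesis using i subgroup.m_inv_closed[OF B] unfolding L_def by blast
    qed
    show "b \<otimes> c \<in> L" if bc: "b \<in> L" "c \<in> L" for b c
    proof -
      obtain i j where ij: "b \<in> B" "\<forall>x\<in>carrier P. pr b x = pr f x ^ i"
        "c \<in> B" "\<forall>x\<in>carrier P. pr c x = pr f x ^ j" using bc by (auto simp: L_def)
      then have "\<forall>x\<in>carrier P. pr (b \<otimes> c) x = pr f x ^ (i + j)" by (simp add: pr_mult power_add)
      then show ?thesis using ij subgroup.m_closed[OF B] unfolding L_def by blast
    qed
  qed
  have LT: "L \<subseteq> T"
    using SP by (auto simp: L_def T_def S_inv)
  have KL: "K \<subseteq> L"
  proof
    fix b assume "b \<in> K"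
    then have "b \<in> B" "\<forall>x\<in>carrier P. pr b x = pr f x ^ 0" by (auto simp: K_def)
    then show "b \<in> L" unfolding L_def by blast
  qed
  have K0: "card K > 0"
  proof -
    have "\<one> \<in> K" using pr_one subgroup.one_closed[OF B] by (simp add: K_def)
    moreover have "finite K" using finB by (simp add: K_def)
    ultimately show ?thesis by (auto simp: card_gt_0_iff)
  qed
  have cardL: "card L = card (vals ` L) * card K"
    unfolding K_def by (rule card_eq_card_vals_mult[OF L LB KL[unfolded K_def]])
  have cardT: "card T = card (vals ` T) * card K"
    unfolding K_def by (rule card_eq_card_vals_mult[OF T TB subset_trans[OF KL LT, unfolded K_def]])
  have finT: "finite (vals ` T)" using finB TB finite_subset by blast

  \<comment> \<open>\<open>p ^ e\<close> is the order of \<open>f\<close> modulo \<open>K\<close>;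
    below, identities between values of powers of \<open>f\<close> become congruences modulo
    \<open>p ^ e\<close>.\<close>
  define e where "e = (LEAST e. \<forall>x\<in>carrier P. pr f x ^ (p ^ e) = 1)"
  have e: "\<forall>x\<in>carrier P. pr f x ^ (p ^ e) = 1"
    unfolding e_def by (rule LeastI[of _ k]) (use pr_power_order[OF f] in simp)
  have e_min: "e \<le> d" if "\<forall>x\<in>carrier P. pr f x ^ (p ^ d) = 1" for d
    unfolding e_def using that by (rule Least_le)
  have pow_one: "p ^ e dvd n \<longleftrightarrow> (\<forall>x\<in>carrier P. pr f x ^ n = 1)" for n
  proof
    assume "p ^ e dvd n"
    then show "\<forall>x\<in>carrier P. pr f x ^ n = 1" using e by (auto simp: power_mult elim!: dvdE)
  next
    assume n: "\<forall>x\<in>carrier P. pr f x ^ n = 1"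
    obtain d where d: "gcd n (p ^ e) = p ^ d" "d \<le> e"
      using divides_primepow_nat[OF prime, of "gcd n (p ^ e)" e] by auto
    have "pr f x ^ (p ^ d) = 1" if x: "x \<in> carrier P" for x
    proof (cases "n = 0")
      case True
      then show ?thesis using d e x by simp
    next
      case False
      then obtain u v where uv: "n * u = p ^ e * v + p ^ d"
        using bezout_nat[of n "p ^ e"] d by metis
      have "pr f x ^ (n * u) = pr f x ^ (p ^ e * v) * pr f x ^ (p ^ d)" by (simp only: uv power_add)
      then show ?thesis using n e x by (simp add: power_mult)
    qed
    then have "e \<le> d" using e_min by blast
    then show "p ^ e dvd n" using d by (metis gcd_dvd1 le_antisym)
  qed
  have pow_eq_le: "[a = c] (mod p ^ e)"
    if eq: "\<forall>x\<in>carrier P. pr f x ^ a = pr f x ^ c" and le: "a \<le> c" for a c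
  proof -
    have "pr f x ^ (c - a) = 1" if x: "x \<in> carrier P" for x
    proof -
      have "pr f x ^ (c - a) * pr f x ^ a = pr f x ^ c"
        using le by (simp flip: power_add)
      then have "pr f x ^ (c - a) * pr f x ^ a = 1 * pr f x ^ a" using eq x by simp
      then show ?thesis using pr_nonzero[OF f x] by (simp only: mult_cancel_right power_eq_0_iff) simp
    qed
    then have "p ^ e dvd c - a" using pow_one by blast
    then show ?thesis using le cong_altdef_nat cong_sym by blast
  qed
  have pow_eq: "[a = c] (mod p ^ e)" if "\<forall>x\<in>carrier P. pr f x ^ a = pr f x ^ c" for a c
    using pow_eq_le[of a c] pow_eq_le[of c a] that cong_sym nat_le_linear by metis
  have pow_cong: "pr f x ^ a = pr f x ^ c" if ac: "[a = c] (mod p ^ e)" and x: "x \<in> carrier P" for a c x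
  proof -
    have red: "pr f x ^ n = pr f x ^ (n mod p ^ e)" for n
    proof -
      have "pr f x ^ n = pr f x ^ (p ^ e * (n div p ^ e) + n mod p ^ e)" by simp
      also have "\<dots> = pr f x ^ (n mod p ^ e)" using e x by (simp only: power_add power_mult power_one mult_1)
      finally show ?thesis .
    qed
    show ?thesis using red[of a] red[of c] ac by (simp add: cong_def)
  qed

  have card_vals_L: "card (vals ` L) = p ^ e"
  proof -
    have "vals ` L = (\<lambda>i. vals (f [^] i)) ` {..<p ^ e}"
    proof (intro equalityI subsetI)
      fix v assume "v \<in> vals ` L"
      then obtain b i where b: "v = vals b" "b \<in> B" "\<forall>x\<in>carrier P. pr b x = pr f x ^ i" by (auto simp: L_def)
      have "vals b = vals (f [^] (i mod p ^ e))"
        using b f pow_cong[of i "i mod p ^ e"] by (simp add: vals_eq_iff pr_pow cong_def)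
      then show "v \<in> (\<lambda>i. vals (f [^] i)) ` {..<p ^ e}" using b(1) pgt by auto
    next
      fix v assume "v \<in> (\<lambda>i. vals (f [^] i)) ` {..<p ^ e}"
      then obtain i :: nat where i: "v = vals (f [^] i)" by auto
      have "\<forall>x\<in>carrier P. pr (f [^] i) x = pr f x ^ i" using f by (simp add: pr_pow)
      then have "f [^] i \<in> L" using f B_pow unfolding L_def by blast
      then show "v \<in> vals ` L" using i by blast
    qed
    moreover have "inj_on (\<lambda>i. vals (f [^] i)) {..<p ^ e}"
    proof (rule inj_onI)
      fix i j :: nat assume ij: "i \<in> {..<p ^ e}" "j \<in> {..<p ^ e}" "vals (f [^] i) = vals (f [^] j)"
      then have "\<forall>x\<in>carrier P. pr f x ^ i = pr f x ^ j" using f by (simp add: vals_eq_iff pr_pow)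
      then have "[i = j] (mod p ^ e)" by (rule pow_eq)
      then show "i = j" using ij by (simp add: cong_def)
    qed
    ultimately show ?thesis by (simp add: card_image)
  qed

  obtain j where j: "card T = p ^ j * card L"
  proof -
    obtain a c where ac: "card L = p ^ a" "card T = p ^ c"
      using card_dvd_prime_power[OF L] card_dvd_prime_power[OF T] divides_primepow_nat[OF prime] by metis
    have "card L \<le> card T" using LT finite_subgroup[OF T] by (simp add: card_mono)
    then have "a \<le> c" using ac pgt1 by simp
    then have "card T = p ^ (c - a) * card L" using ac by (simp add: power_add[symmetric])
    then show thesis by (rule that)
  qed
  have card_vals_T: "card (vals ` T) = p ^ (e + j)"
    using j cardT cardL card_vals_L K0 by (simp add: power_add mult.commute mult.left_commute)

  \<comment> \<open>By \<open>pr_commute\<close>, conjugates of \<open>f\<close> inherit its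
    invariance under \<open>S\<close>.\<close>
  have conjT: "inv g \<otimes> f \<otimes> g \<in> T" if g: "g \<in> carrier P" for g
  proof -
    have "pr f (g \<otimes> (h \<otimes> x)) = pr f (g \<otimes> x)" if "h \<in> S" "x \<in> carrier P" for h x
      using pr_commute[of g h x f] S_inv[of h "g \<otimes> x"] SP that g f by simp
    then show ?thesis using g f conj_closed SP by (simp add: T_def pr_conj)
  qed
  \<comment> \<open>\<open>trans g\<close> records a conjugate of \<open>f\<close> modulo
    \<open>K\<close>, so \<open>Orb\<close> is an orbit with stabilizer \<open>S\<close>.\<close>
  define trans where "trans g = restrict (\<lambda>x. pr f (g \<otimes> x)) (carrier P)" for g
  define Orb where "Orb = trans ` carrier P"
  have trans_vals: "trans g = vals (inv g \<otimes> f \<otimes> g)" if "g \<in> carrier P" for g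
    using that f by (auto simp: trans_def vals_def pr_conj)
  have trans_eq: "trans g = trans h \<longleftrightarrow> g \<otimes> inv h \<in> S" if gh: "g \<in> carrier P" "h \<in> carrier P" for g h
  proof -
    have "trans g = trans h \<longleftrightarrow> (\<forall>x\<in>carrier P. pr f (g \<otimes> x) = pr f (h \<otimes> x))"
      unfolding trans_def restrict_def fun_eq_iff by auto
    also have "\<dots> \<longleftrightarrow> (\<forall>x\<in>carrier P. pr f (g \<otimes> inv h \<otimes> x) = pr f x)"
    proof (intro iffI ballI)
      fix x assume eq: "\<forall>x\<in>carrier P. pr f (g \<otimes> x) = pr f (h \<otimes> x)" and x: "x \<in> carrier P"
      have "pr f (g \<otimes> (inv h \<otimes> x)) = pr f (h \<otimes> (inv h \<otimes> x))" using eq gh x by simp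
      then show "pr f (g \<otimes> inv h \<otimes> x) = pr f x" using gh x by (simp add: m_assoc[symmetric])
    next
      fix x assume eq: "\<forall>x\<in>carrier P. pr f (g \<otimes> inv h \<otimes> x) = pr f x" and x: "x \<in> carrier P"
      have "pr f (g \<otimes> inv h \<otimes> (h \<otimes> x)) = pr f (h \<otimes> x)" using eq gh x by simp
      moreover have "g \<otimes> inv h \<otimes> (h \<otimes> x) = g \<otimes> x" using gh x by (simp add: m_assoc) (simp add: m_assoc[symmetric])
      ultimately show "pr f (g \<otimes> x) = pr f (h \<otimes> x)" by simp
    qed
    also have "\<dots> \<longleftrightarrow> g \<otimes> inv h \<in> S" using gh by (simp add: S_eq)
    finally show ?thesis .
  qed
  have orbit: "Coset.order P = card Orb * card S"
  proof -
    have "Coset.order P = card (carrier P)" by (simp add: Coset.order_def)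
    \<comment> \<open>\<open>trans\<close> is constant on right cosets of \<open>S\<close>, whereas
      the counting lemma works with left cosets; hence the inverses.\<close>
    also have "\<dots> = card ((\<lambda>g. trans (inv g)) ` carrier P) * card S"
    proof (rule card_eq_card_image_mult[OF subgroup_self fin subgroup.subset[OF S(1)]])
      fix g h assume "g \<in> carrier P" "h \<in> carrier P"
      then show "trans (inv g) = trans (inv h) \<longleftrightarrow> inv g \<otimes> h \<in> S" by (simp add: trans_eq)
    qed
    also have "(\<lambda>g. trans (inv g)) ` carrier P = Orb"
    proof -
      have "(\<lambda>g. inv g) ` carrier P = carrier P"
        by (auto simp: image_iff) (metis inv_closed inv_inv)
      then show ?thesis unfolding Orb_def by (metis image_image)
    qed
    finally show ?thesis .
  qed
  have OrbT: "Orb \<subseteq> vals ` T" using conjT by (auto simp: Orb_def trans_vals)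
  have "card Orb \<le> p ^ (2 * j)"
  proof (cases "e \<le> j")
    case True
    \<comment> \<open>The conjugates lie in \<open>T\<close>, which has \<open>p ^ (e + j)\<close>
      elements modulo \<open>K\<close>.\<close>
    have "card Orb \<le> p ^ (e + j)" using card_mono[OF finT OrbT] card_vals_T by simp
    also have "\<dots> \<le> p ^ (2 * j)" using True pgt by (intro power_increasing) auto
    finally show ?thesis .
  next
    case False
    then have je: "j < e" by simp
    \<comment> \<open>The values of \<open>f\<close> to the power \<open>p ^ (e - 1)\<close>, an
      element of order \<open>p\<close> modulo \<open>K\<close>. \<open>z_const\<close> says that it
      is central modulo \<open>K\<close>.\<close>
    define z where "z x = pr f x ^ (p ^ (e - 1))" for x
    have zp: "z x ^ p = 1" if "x \<in> carrier P" for x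
      using e that je by (simp add: z_def power_mult[symmetric] power_Suc2[symmetric] del: power_Suc)
    have L_normal: "x \<otimes> h \<otimes> inv x \<in> L" if xh: "x \<in> T" "h \<in> L" for x h
    proof -
      have x: "x \<in> B" "x \<in> carrier P" and h: "h \<in> B" using xh TB LB B_carrier by auto
      have "pr (x \<otimes> h \<otimes> inv x) y = pr h y" if "y \<in> carrier P" for y
        using inertia[of "inv x"] subgroup.m_inv_closed[OF B x(1)] pr_conj_inv[OF x(2) that h] x h that by simp
      then show ?thesis using xh conj_inv_closed[OF x(2) h] by (simp add: L_def)
    qed
    have z_const: "z g = z \<one>" if g: "g \<in> carrier P" for g
    proof -
      \<comment> \<open>\<open>L\<close> has index \<open>p ^ j\<close> in \<open>T\<close>, so this
        power of the conjugate is the \<open>i\<close>-th power of \<open>f\<close> modulo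
        \<open>K\<close>; comparing orders gives \<open>p ^ j dvd i\<close>.\<close>
      have "(inv g \<otimes> f \<otimes> g) [^] (p ^ j) \<in> L"
        by (rule pow_index_mem[OF T L LT fin L_normal j conjT[OF g]])
      then obtain i where i: "\<And>x. x \<in> carrier P \<Longrightarrow> pr f (g \<otimes> x) ^ (p ^ j) = pr f x ^ i"
        using g f conj_closed by (auto simp: L_def pr_pow pr_conj)
      have "pr f x ^ (i * p ^ (e - j)) = 1" if x: "x \<in> carrier P" for x
      proof -
        have "pr f x ^ (i * p ^ (e - j)) = pr f (g \<otimes> x) ^ (p ^ j * p ^ (e - j))"
          using i[OF x] by (simp add: power_mult)
        also have "p ^ j * p ^ (e - j) = p ^ e" using je by (simp add: power_add[symmetric])
        finally show ?thesis using e g x by simp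
      qed
      then have "p ^ e dvd i * p ^ (e - j)" using pow_one by blast
      moreover have "p ^ e = p ^ j * p ^ (e - j)" using je by (simp add: power_add[symmetric])
      ultimately have "p ^ j dvd i" using pgt by simp
      then obtain u where u: "i = p ^ j * u" by blast
      \<comment> \<open>Conjugation by \<open>g\<close> thus acts on the group of order
        \<open>p\<close> generated by the power \<open>p ^ (e - 1)\<close> of \<open>f\<close> as
        the power map \<open>u\<close>.\<close>
      have zu: "pr f (g \<otimes> x) ^ (p ^ (e - 1)) = (pr f x ^ (p ^ (e - 1))) ^ u" if x: "x \<in> carrier P" for x
      proof -
        have q: "p ^ (e - 1) = p ^ j * p ^ (e - 1 - j)" using je by (simp add: power_add[symmetric])
        have "pr f (g \<otimes> x) ^ (p ^ (e - 1)) = (pr f x ^ i) ^ (p ^ (e - 1 - j))"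
          unfolding q using i[OF x] by (simp only: power_mult)
        also have "\<dots> = (pr f x ^ (p ^ (e - 1))) ^ u"
          unfolding q u by (simp add: power_mult[symmetric] mult_ac)
        finally show ?thesis .
      qed
      \<comment> \<open>The order of \<open>g\<close> divides \<open>p ^ k\<close>, so the
        \<open>p ^ k\<close>-th iterate of this power map is the identity; by Fermat it is also the
        power map \<open>u\<close> itself.\<close>
      have "z \<one> = z \<one> ^ (u ^ (p ^ k))"
        using pr_pow_translate[OF g f zu one_closed, of "p ^ k"] pow_order_eq_1[OF _ ] g fin ord_P
        by (simp add: z_def)
      also have "\<dots> = z \<one> ^ u"
      proof -
        have red: "z \<one> ^ n = z \<one> ^ (n mod p)" for n
        proof -
          have "z \<one> ^ n = z \<one> ^ (p * (n div p) + n mod p)" by simp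
          also have "\<dots> = z \<one> ^ (n mod p)" using zp[OF one_closed] by (simp only: power_add power_mult power_one mult_1)
          finally show ?thesis .
        qed
        show ?thesis using red[of "u ^ (p ^ k)"] red[of u] power_prime_power_cong[OF prime, of u k] by (simp add: cong_def)
      qed
      also have "\<dots> = z g" using zu[OF one_closed] g by (simp add: z_def)
      finally show ?thesis by simp
    qed
    have z1: "z \<one> \<noteq> 1"
    proof
      assume "z \<one> = 1"
      then have "\<forall>x\<in>carrier P. pr f x ^ (p ^ (e - 1)) = 1" using z_const by (auto simp: z_def)
      then show False using e_min[of "e - 1"] je by simp
    qed
    have f_live: "f \<in> live (carrier P)"
    proof -
      have "(\<Sum>c\<in>carrier P. pr f (c \<otimes> \<one>)) = (\<Sum>c\<in>carrier P. pr f c)" by (rule sum.cong) auto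
      then show ?thesis using nz f one_closed unfolding live_def by force
    qed
    have power_stab: "g \<in> S" if g: "g \<in> carrier P" and u: "\<And>x. x \<in> carrier P \<Longrightarrow> pr f (g \<otimes> x) = pr f x ^ u" for g u
    proof (rule ccontr)
      assume nS: "g \<notin> S"
      have tr: "pr f (g [^] m \<otimes> x) = pr f x ^ (u ^ m)" if "x \<in> carrier P" for m :: nat and x
        using pr_pow_translate[OF g f, of 1 u x m] u that by simp
      \<comment> \<open>The order of \<open>g\<close> divides \<open>p ^ k\<close>; reducing the
        resulting congruence modulo \<open>p\<close> gives u = 1 modulo \<open>p\<close>.\<close>
      have "\<forall>x\<in>carrier P. pr f x ^ (u ^ (p ^ k)) = pr f x ^ 1"
        using tr[of _ "p ^ k"] pow_order_eq_1[OF g] fin ord_P by simp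
      then have "[u ^ (p ^ k) = 1] (mod p ^ e)" by (rule pow_eq)
      then have "[u ^ (p ^ k) = 1] (mod p)" using je cong_dvd_modulus_nat dvd_power[of e p] by auto
      then have u1: "[u = 1] (mod p)" using power_prime_power_cong[OF prime, of u k] cong_sym cong_trans by metis
      have un: "\<not> [u = 1] (mod p ^ e)"
      proof
        assume "[u = 1] (mod p ^ e)"
        then have "\<forall>x\<in>carrier P. pr f (g \<otimes> x) = pr f x" using u pow_cong[of u 1] by simp
        then show False using nS S_eq[OF g] by simp
      qed
      have u0: "u \<noteq> 0" using u1 pgt1 by (intro notI) (simp add: cong_def)
      have int_cong: "int d dvd int (u ^ m) - 1 \<longleftrightarrow> [u ^ m = 1] (mod d)" for d m
        by (metis cong_iff_dvd_diff cong_int_iff of_nat_1)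
      have "int p dvd int u - 1" "\<not> int p ^ Suc (e - 1) dvd int u - 1"
        using int_cong[of p 1] int_cong[of "p ^ e" 1] u1 un je by simp_all
      \<comment> \<open>An iterate whose power map is trivial modulo \<open>p ^ (e - 1)\<close> but
        not modulo \<open>p ^ e\<close>: it multiplies \<open>pr f\<close> by a power of the
        constant \<open>z \<one>\<close> with exponent prime to \<open>p\<close>, so
        \<open>f\<close> cannot be live.\<close>
      then obtain m where m: "int p ^ (e - 1) dvd int u ^ m - 1" "\<not> int p ^ Suc (e - 1) dvd int u ^ m - 1"
        using exists_power_near_one[OF prime odd] by metis
      have m1: "p ^ (e - 1) dvd u ^ m - 1"
      proof -
        have "int (u ^ m - 1) = int u ^ m - 1" using u0 by (simp add: of_nat_diff Suc_leI)
        then show ?thesis using m(1) by (metis int_dvd_int_iff of_nat_power)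
      qed
      then obtain c where c: "u ^ m = 1 + p ^ (e - 1) * c"
        using u0 by (metis dvdE le_add_diff_inverse One_nat_def Suc_leI neq0_conv zero_less_power)
      have pc: "\<not> p dvd c"
      proof
        assume "p dvd c"
        then obtain d where "c = p * d" by blast
        then have "int u ^ m - 1 = int p ^ Suc (e - 1) * int d"
          using c by (metis (no_types, lifting) add_diff_cancel_left' mult.assoc mult.commute of_nat_1 of_nat_add of_nat_mult of_nat_power power_Suc)
        then show False using m(2) by simp
      qed
      have zc: "z \<one> ^ c \<noteq> 1"
      proof
        assume zc: "z \<one> ^ c = 1"
        have "coprime c p" using pc prime by (metis coprime_commute prime_imp_coprime)
        moreover have "c \<noteq> 0" using pc by (intro notI) simp
        ultimately obtain a b where "c * a = p * b + 1" using bezout_nat[of c p] by auto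
        then have "z \<one> ^ (p * b + 1) = 1" using zc by (metis power_mult power_one)
        then show False using zp[OF one_closed] z1 by (simp add: power_add power_mult)
      qed
      have "f \<notin> live (carrier P)"
      proof (rule not_liveI[OF subgroup_self _ f _ zc])
        show "g [^] m \<in> carrier P" using g by simp
        fix x assume x: "x \<in> carrier P"
        have "pr f (g [^] m \<otimes> x) = pr f x * z x ^ c"
          using tr[OF x, of m] by (simp add: c power_add power_mult z_def)
        then show "pr f (g [^] m \<otimes> x) = z \<one> ^ c * pr f x" using z_const[OF x] by simp
      qed
      then show False using f_live by simp
    qed
    show ?thesis
    proof (cases "j = 0")
      case True
      \<comment> \<open>Every conjugate of \<open>f\<close> is now a power of \<open>f\<close>
        modulo \<open>K\<close>, so the orbit is a single point.\<close>
      then have "L = T" using j LT finite_subgroup[OF T] by (intro card_subset_eq) auto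
      have "g \<in> S" if g: "g \<in> carrier P" for g
      proof -
        have "inv g \<otimes> f \<otimes> g \<in> L" using conjT[OF g] \<open>L = T\<close> by simp
        then obtain i where "\<forall>x\<in>carrier P. pr f (g \<otimes> x) = pr f x ^ i"
          using g f by (auto simp: L_def pr_conj)
        then show ?thesis using power_stab[OF g] by blast
      qed
      then have "S = carrier P" using SP by blast
      then have "card Orb * card S = 1 * card S"
        using orbit by (simp only: Coset.order_def mult_1)
      moreover have "card S \<noteq> 0"
        using finite_subgroup[OF S(1)] subgroup.one_closed[OF S(1)] by auto
      ultimately have "card Orb = 1" by (simp only: mult_cancel2) simp
      then show ?thesis using pgt by (simp add: Suc_leI)
    next
      case False
      \<comment> \<open>Powers of conjugates with exponents 1 modulo \<open>p\<close>;
        \<open>i < p ^ (e - 1)\<close> represents each such exponent once modulo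
        \<open>p ^ e\<close>.\<close>
      define \<Phi> where "\<Phi> = (\<lambda>(i, w). restrict (\<lambda>x. w x ^ (1 + p * i)) (carrier P) :: 'a \<Rightarrow> complex)"
      have "inj_on \<Phi> ({..<p ^ (e - 1)} \<times> Orb)"
      proof (rule inj_onI, clarify)
        fix i w i' w'
        assume i: "i < p ^ (e - 1)" "i' < p ^ (e - 1)" and w: "w \<in> Orb" "w' \<in> Orb"
          and eq: "\<Phi> (i, w) = \<Phi> (i', w')"
        obtain g h where g: "g \<in> carrier P" "w = trans g" and h: "h \<in> carrier P" "w' = trans h"
          using w by (auto simp: Orb_def)
        have eq': "pr f (g \<otimes> x) ^ (1 + p * i) = pr f (h \<otimes> x) ^ (1 + p * i')" if "x \<in> carrier P" for x
          using fun_cong[OF eq, of x] that g h by (simp add: \<Phi>_def trans_def)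
        have "coprime (1 + p * i) (p ^ e)"
        proof -
          have "coprime (1 + p * i) p"
            by (rule coprimeI) (metis dvd_add_left_iff dvd_mult2)
          then show ?thesis by simp
        qed
        \<comment> \<open>Raising to the inverse \<open>v\<close> of \<open>1 + p * i\<close> turns
          equality of the two powers into a conjugate of \<open>f\<close> being a power of
          \<open>f\<close>, to which \<open>power_stab\<close> applies.\<close>
        then obtain v where v: "[(1 + p * i) * v = 1] (mod p ^ e)"
          using cong_solve_coprime_nat[of "1 + p * i" "p ^ e"] by auto
        define gh where "gh = g \<otimes> inv h"
        have gh: "gh \<in> carrier P" using g h by (simp add: gh_def)
        have "pr f (gh \<otimes> x) = pr f x ^ ((1 + p * i') * v)" if x: "x \<in> carrier P" for x
        proof -
          have y: "inv h \<otimes> x \<in> carrier P" "gh \<otimes> x = g \<otimes> (inv h \<otimes> x)" "h \<otimes> (inv h \<otimes> x) = x"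
            using g h x by (simp_all add: gh_def m_assoc) (simp add: m_assoc[symmetric])
          have "pr f (gh \<otimes> x) = pr f (gh \<otimes> x) ^ ((1 + p * i) * v)"
            using pow_cong[OF v, of "gh \<otimes> x"] gh x by simp
          also have "\<dots> = (pr f (gh \<otimes> x) ^ (1 + p * i)) ^ v" by (rule power_mult)
          also have "\<dots> = (pr f x ^ (1 + p * i')) ^ v" using eq'[OF y(1)] y by simp
          finally show ?thesis by (simp only: power_mult)
        qed
        then have "gh \<in> S" by (rule power_stab[OF gh])
        then have ww: "w = w'" using trans_eq g h by (simp add: gh_def)
        have "pr f x ^ (1 + p * i) = pr f x ^ (1 + p * i')" if x: "x \<in> carrier P" for x
        proof -
          have "pr f (g \<otimes> (inv g \<otimes> x)) = pr f (h \<otimes> (inv g \<otimes> x))"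
            using fun_cong[OF ww, of "inv g \<otimes> x"] g h x by (simp add: trans_def)
          moreover have "g \<otimes> (inv g \<otimes> x) = x" using g x by (simp add: m_assoc[symmetric])
          ultimately show ?thesis using eq'[of "inv g \<otimes> x"] g x by simp
        qed
        then have "[1 + p * i = 1 + p * i'] (mod p ^ e)" by (intro pow_eq) simp
        moreover have small: "1 + p * a < p ^ e" if "a < p ^ (e - 1)" for a
        proof -
          have "p * (a + 1) \<le> p * p ^ (e - 1)" using that by (intro mult_le_mono2) simp
          also have "\<dots> = p ^ e" using je by (simp add: power_Suc[symmetric] del: power_Suc)
          finally show ?thesis using pgt1 by simp
        qed
        ultimately have "1 + p * i = 1 + p * i'" using small[OF i(1)] small[OF i(2)] by (simp only: cong_def mod_less)
        then show "i = i' \<and> w = w'" using ww pgt by simp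
      qed
      then have "card (\<Phi> ` ({..<p ^ (e - 1)} \<times> Orb)) = p ^ (e - 1) * card Orb"
        by (simp add: card_image card_cartesian_product)
      moreover have "\<Phi> ` ({..<p ^ (e - 1)} \<times> Orb) \<subseteq> vals ` T"
      proof clarify
        fix i w assume "w \<in> Orb"
        then obtain g where g: "g \<in> carrier P" "w = trans g" by (auto simp: Orb_def)
        have c: "inv g \<otimes> f \<otimes> g \<in> B" using g f conj_closed by simp
        have "pr ((inv g \<otimes> f \<otimes> g) [^] (1 + p * i)) x = pr f (g \<otimes> x) ^ (1 + p * i)"
          if "x \<in> carrier P" for x
          using pr_pow[OF c that] pr_conj[OF g(1) that f] by (simp only:)
        then have "\<Phi> (i, w) = vals ((inv g \<otimes> f \<otimes> g) [^] (1 + p * i))"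
          using g unfolding \<Phi>_def trans_def vals_def by (auto intro!: restrict_ext)
        moreover have "(inv g \<otimes> f \<otimes> g) [^] (1 + p * i) \<in> T"
          using T_pow[OF conjT[OF g(1)]] .
        ultimately show "\<Phi> (i, w) \<in> vals ` T" by blast
      qed
      ultimately have "p ^ (e - 1) * card Orb \<le> p ^ (e + j)"
        using card_mono[OF finT] card_vals_T by metis
      also have "e + j = (e - 1) + (j + 1)" using je by simp
      finally have "p ^ (e - 1) * card Orb \<le> p ^ (e - 1) * p ^ (j + 1)" by (simp only: power_add)
      then have "card Orb \<le> p ^ (j + 1)" using pgt by simp
      \<comment> \<open>\<open>j\<close> is positive in this case.\<close>
      also have "\<dots> \<le> p ^ (2 * j)" using False pgt by (intro power_increasing) auto
      finally show ?thesis .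
    qed
  qed
  then have "Coset.order P \<le> p ^ (2 * j) * card S" using orbit by simp
  \<comment> \<open>This is the order of \<open>f\<close> in \<open>P\<close> itself:
    \<open>L\<close> contains the cyclic group of \<open>f\<close>, not only its image modulo
    \<open>K\<close>.\<close>
  moreover have "ord f \<le> card L"
  proof -
    have "\<forall>x\<in>carrier P. pr f x = pr f x ^ 1" by simp
    then have "f \<in> L" using f unfolding L_def by blast
    then have "generate P {f} \<subseteq> L" using generate_subgroup_incl[OF _ L] by simp
    then show ?thesis
      using generate_pow_card[OF B_carrier[OF f]] card_mono[OF finite_subgroup[OF L]] by simp
  qed
  ultimately have "Coset.order P * ord f ^ 2 \<le> (p ^ (2 * j) * card S) * card L ^ 2"
    by (intro mult_le_mono power_mono) auto
  \<comment> \<open>The factor \<open>p ^ (2 * j)\<close> turns both copies of \<open>card L\<close>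
    into \<open>card T\<close>.\<close>
  also have "\<dots> = card S * card T * card T"
    unfolding j by (simp add: power2_eq_square mult_2 power_add)
  also have "\<dots> \<le> card B ^ 2 * card B"
  proof (intro mult_le_mono)
    show "card S * card T \<le> card B ^ 2"
    proof (rule card_stab_mult_le[OF S TB])
      fix b g assume bg: "b \<in> T" "g \<in> S"
      then have "pr b (g \<otimes> \<one>) = pr b \<one>" by (simp add: T_def)
      then show "pr b g = pr b \<one>" using SP bg by simp
    qed
    show "card T \<le> card B" using TB finB by (rule card_mono[rotated])
  qed
  also have "\<dots> = card B ^ 3" by (simp add: power3_eq_cube power2_eq_square)
  finally show ?thesis .
qed

end

section \<open>Irreducible representations of metabelian groups\<close>

lemma index_mult_mat_vec_sum:
  fixes A :: "complex mat"
  assumes "A \<in> carrier_mat n n" "w \<in> carrier_vec n" "i < n"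
  shows "(A *\<^sub>v w) $ i = (\<Sum>k<n. A $$ (i, k) * w $ k)"
  using assms by (simp add: scalar_prod_def lessThan_atLeast0)

lemma index_mult_mat_sum:
  fixes A C :: "complex mat"
  assumes "A \<in> carrier_mat n n" "C \<in> carrier_mat n n" "i < n" "j < n"
  shows "(A * C) $$ (i, j) = (\<Sum>k<n. A $$ (i, k) * C $$ (k, j))"
  using assms by (simp add: scalar_prod_def lessThan_atLeast0)

text \<open>Given by coordinates, so that the dimension is \<open>n\<close> for every index set and
  calculations reduce to sums of complex numbers.\<close>

definition vec_sum :: "nat \<Rightarrow> ('i \<Rightarrow> complex vec) \<Rightarrow> 'i set \<Rightarrow> complex vec" where
  "vec_sum n f T = vec n (\<lambda>i. \<Sum>t\<in>T. f t $ i)"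

lemma vec_sum_carrier [simp]: "vec_sum n f T \<in> carrier_vec n"
  by (simp add: vec_sum_def)

lemma vec_sum_cong: "(\<And>t. t \<in> T \<Longrightarrow> f t = g t) \<Longrightarrow> vec_sum n f T = vec_sum n g T"
  by (simp add: vec_sum_def)

lemma mult_vec_sum:
  assumes "A \<in> carrier_mat n n" "\<And>t. t \<in> T \<Longrightarrow> f t \<in> carrier_vec n"
  shows "A *\<^sub>v vec_sum n f T = vec_sum n (\<lambda>t. A *\<^sub>v f t) T"
proof (rule eq_vecI)
  fix i assume "i < dim_vec (vec_sum n (\<lambda>t. A *\<^sub>v f t) T)"
  then have i: "i < n" by (simp add: vec_sum_def)
  have "(A *\<^sub>v vec_sum n f T) $ i = (\<Sum>k<n. A $$ (i, k) * (\<Sum>t\<in>T. f t $ k))"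
    unfolding index_mult_mat_vec_sum[OF assms(1) vec_sum_carrier i] by (simp add: vec_sum_def)
  also have "\<dots> = (\<Sum>t\<in>T. \<Sum>k<n. A $$ (i, k) * f t $ k)"
    by (simp add: sum_distrib_left sum.swap[of _ T])
  also have "\<dots> = (\<Sum>t\<in>T. (A *\<^sub>v f t) $ i)"
    by (rule sum.cong[OF refl]) (rule index_mult_mat_vec_sum[OF assms(1) assms(2) i, symmetric])
  finally show "(A *\<^sub>v vec_sum n f T) $ i = vec_sum n (\<lambda>t. A *\<^sub>v f t) T $ i"
    using i by (simp add: vec_sum_def)
qed (use assms in \<open>auto simp: vec_sum_def\<close>)

lemma smult_vec_sum:
  assumes "\<And>t. t \<in> T \<Longrightarrow> f t \<in> carrier_vec n"
  shows "c \<cdot>\<^sub>v vec_sum n f T = vec_sum n (\<lambda>t. c \<cdot>\<^sub>v f t) T"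
proof (rule eq_vecI)
  fix i assume "i < dim_vec (vec_sum n (\<lambda>t. c \<cdot>\<^sub>v f t) T)"
  then have i: "i < n" by (simp add: vec_sum_def)
  have "c * f t $ i = (c \<cdot>\<^sub>v f t) $ i" if "t \<in> T" for t
    using carrier_vecD[OF assms[OF that]] i by simp
  then show "(c \<cdot>\<^sub>v vec_sum n f T) $ i = vec_sum n (\<lambda>t. c \<cdot>\<^sub>v f t) T $ i"
    using i by (simp add: vec_sum_def sum_distrib_left)
qed (simp add: vec_sum_def)

definition mat_sum :: "nat \<Rightarrow> ('i \<Rightarrow> complex mat) \<Rightarrow> 'i set \<Rightarrow> complex mat" where
  "mat_sum n f T = mat n n (\<lambda>ij. \<Sum>t\<in>T. f t $$ ij)"

lemma mat_sum_carrier [simp]: "mat_sum n f T \<in> carrier_mat n n"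
  by (simp add: mat_sum_def)

lemma mat_sum_mult_vec:
  assumes "w \<in> carrier_vec n" "\<And>t. t \<in> T \<Longrightarrow> f t \<in> carrier_mat n n"
  shows "mat_sum n f T *\<^sub>v w = vec_sum n (\<lambda>t. f t *\<^sub>v w) T"
proof (rule eq_vecI)
  fix i assume "i < dim_vec (vec_sum n (\<lambda>t. f t *\<^sub>v w) T)"
  then have i: "i < n" by (simp add: vec_sum_def)
  have "(mat_sum n f T *\<^sub>v w) $ i = (\<Sum>k<n. (\<Sum>t\<in>T. f t $$ (i, k)) * w $ k)"
    unfolding index_mult_mat_vec_sum[OF mat_sum_carrier assms(1) i] using i by (simp add: mat_sum_def)
  also have "\<dots> = (\<Sum>t\<in>T. \<Sum>k<n. f t $$ (i, k) * w $ k)"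
    by (simp add: sum_distrib_right sum.swap[of _ T])
  also have "\<dots> = (\<Sum>t\<in>T. (f t *\<^sub>v w) $ i)"
    by (rule sum.cong[OF refl]) (rule index_mult_mat_vec_sum[OF assms(2) assms(1) i, symmetric])
  finally show "(mat_sum n f T *\<^sub>v w) $ i = vec_sum n (\<lambda>t. f t *\<^sub>v w) T $ i"
    using i by (simp add: vec_sum_def)
qed (use assms in \<open>auto simp: vec_sum_def mat_sum_def\<close>)

lemma mult_mat_sum:
  assumes "A \<in> carrier_mat n n" "\<And>t. t \<in> T \<Longrightarrow> f t \<in> carrier_mat n n"
  shows "A * mat_sum n f T = mat_sum n (\<lambda>t. A * f t) T"
proof (rule eq_matI)
  fix i j assume "i < dim_row (mat_sum n (\<lambda>t. A * f t) T)" "j < dim_col (mat_sum n (\<lambda>t. A * f t) T)"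
  then have ij: "i < n" "j < n" by (simp_all add: mat_sum_def)
  have "(A * mat_sum n f T) $$ (i, j) = (\<Sum>k<n. A $$ (i, k) * (\<Sum>t\<in>T. f t $$ (k, j)))"
    unfolding index_mult_mat_sum[OF assms(1) mat_sum_carrier ij] using ij by (simp add: mat_sum_def)
  also have "\<dots> = (\<Sum>t\<in>T. \<Sum>k<n. A $$ (i, k) * f t $$ (k, j))"
    by (simp add: sum_distrib_left sum.swap[of _ T])
  also have "\<dots> = (\<Sum>t\<in>T. (A * f t) $$ (i, j))"
    by (rule sum.cong[OF refl]) (rule index_mult_mat_sum[OF assms(1) assms(2) ij, symmetric])
  finally show "(A * mat_sum n f T) $$ (i, j) = mat_sum n (\<lambda>t. A * f t) T $$ (i, j)"
    using ij by (simp add: mat_sum_def)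
qed (use assms in \<open>auto simp: mat_sum_def\<close>)

lemma mat_trace_mat_sum:
  assumes "\<And>t. t \<in> T \<Longrightarrow> f t \<in> carrier_mat n n"
  shows "mat_trace (mat_sum n f T) = (\<Sum>t\<in>T. mat_trace (f t))"
proof -
  have "mat_trace (mat_sum n f T) = (\<Sum>i<n. \<Sum>t\<in>T. f t $$ (i, i))"
    by (simp add: mat_trace_def mat_sum_def)
  also have "\<dots> = (\<Sum>t\<in>T. \<Sum>i<n. f t $$ (i, i))" by (rule sum.swap)
  also have "\<dots> = (\<Sum>t\<in>T. mat_trace (f t))"
    using assms by (intro sum.cong) (auto simp: mat_trace_def)
  finally show ?thesis .
qed

lemma mat_trace_mult:
  assumes "A \<in> carrier_mat n n" "C \<in> carrier_mat n n"
  shows "mat_trace (A * C) = (\<Sum>i<n. \<Sum>k<n. A $$ (i, k) * C $$ (k, i))"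
  using assms unfolding mat_trace_def
  by (intro sum.cong) (auto simp: scalar_prod_def lessThan_atLeast0 intro!: sum.cong)

lemma mat_trace_mult_commute:
  assumes "A \<in> carrier_mat n n" "C \<in> carrier_mat n n"
  shows "mat_trace (A * C) = mat_trace (C * A)"
  unfolding mat_trace_mult[OF assms] mat_trace_mult[OF assms(2,1)]
  by (subst sum.swap) (simp add: mult.commute)

text \<open>For 0 < t < m the number \<omega>^t is an \<open>m\<close>-th root of unity other than
  1, so its geometric sum vanishes.\<close>

lemma sum_root_of_unity_powers:
  fixes m t :: nat
  assumes "t < m"
  defines "\<omega> \<equiv> cis (2 * pi / real m)"
  shows "(\<Sum>j<m. \<omega> ^ (j * t)) = (if t = 0 then of_nat m else 0)"
proof (cases "t = 0")
  case False
  have "\<omega> ^ m = 1" using assms(1) by (simp add: \<omega>_def DeMoivre)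
  then have "(\<omega> ^ t) ^ m = 1" by (metis power_mult mult.commute power_one)
  moreover have "\<omega> ^ t \<noteq> 1"
  proof
    assume eq: "\<omega> ^ t = 1"
    have "inj_on (\<lambda>k. cis (2 * pi * real k / real m)) {..<m}"
      using bij_betw_roots_unity[of m] assms by (auto simp: bij_betw_def)
    moreover have "cis (2 * pi * real t / real m) = cis (2 * pi * real 0 / real m)"
      using eq by (simp add: \<omega>_def DeMoivre mult.commute)
    ultimately have "t = 0" by (rule inj_onD) (use assms(1) in auto)
    then show False using False by simp
  qed
  ultimately have "(\<Sum>j<m. (\<omega> ^ t) ^ j) = 0"
    using geometric_sum[of "\<omega> ^ t" m] by simp
  then show ?thesis using False by (simp add: power_mult[symmetric] mult.commute)
qed simp

section \<open>Irreducible representations of finite groups and eigenvectors\<close>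

locale irreducible_rep = group P for P (structure) +
  fixes n :: nat and \<rho> :: "'a \<Rightarrow> complex mat"
  assumes fin: "finite (carrier P)" and irr: "irreducible_representation P n \<rho>"
begin

lemma rho_carrier: "g \<in> carrier P \<Longrightarrow> \<rho> g \<in> carrier_mat n n"
  using irr by (auto simp: irreducible_representation_def representation_def hom_def units_of_def
      Units_def ring_mat_simps)

lemma rho_mult: "g \<in> carrier P \<Longrightarrow> h \<in> carrier P \<Longrightarrow> \<rho> (g \<otimes> h) = \<rho> g * \<rho> h"
  using irr by (auto simp: irreducible_representation_def representation_def hom_def units_of_def
      ring_mat_simps)

text \<open>\<open>hom\<close> only asks for multiplicativity, but an invertible idempotent is the
  identity.\<close>

lemma rho_one: "\<rho> \<one> = 1\<^sub>m n"
proof -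
  have "\<rho> \<one> \<in> Units (ring_mat TYPE(complex) n ())"
    using irr by (auto simp: irreducible_representation_def representation_def hom_def units_of_def)
  then obtain A where A: "A \<in> carrier_mat n n" "A * \<rho> \<one> = 1\<^sub>m n"
    by (auto simp: Units_def ring_mat_simps)
  have "\<rho> \<one> = \<rho> \<one> * \<rho> \<one>" using rho_mult[of \<one> \<one>] by simp
  then have "A * \<rho> \<one> = A * \<rho> \<one> * \<rho> \<one>"
    using A rho_carrier[OF one_closed] by (metis assoc_mult_mat)
  then show ?thesis using A rho_carrier[OF one_closed] by simp
qed

lemma rho_vec [simp]: "g \<in> carrier P \<Longrightarrow> w \<in> carrier_vec n \<Longrightarrow> \<rho> g *\<^sub>v w \<in> carrier_vec n"
  using rho_carrier[of g] by simp

lemma rho_mult_vec: "g \<in> carrier P \<Longrightarrow> h \<in> carrier P \<Longrightarrow> w \<in> carrier_vec n \<Longrightarrow>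
    \<rho> (g \<otimes> h) *\<^sub>v w = \<rho> g *\<^sub>v (\<rho> h *\<^sub>v w)"
  using rho_carrier[of g] rho_carrier[of h] by (simp add: rho_mult)

lemma rho_smult: "g \<in> carrier P \<Longrightarrow> w \<in> carrier_vec n \<Longrightarrow> \<rho> g *\<^sub>v (c \<cdot>\<^sub>v w) = c \<cdot>\<^sub>v (\<rho> g *\<^sub>v w)"
  using rho_carrier[of g] by (simp add: mult_mat_vec)

text \<open>The form in which irreducibility is applied: a linear, invariant property that holds at
  one nonzero vector holds at all vectors.\<close>

lemma invariant_eq_carrier:
  assumes W: "W \<subseteq> carrier_vec n" "0\<^sub>v n \<in> W"
    and add: "\<And>u w. u \<in> W \<Longrightarrow> w \<in> W \<Longrightarrow> u + w \<in> W"
    and smult: "\<And>c w. w \<in> W \<Longrightarrow> c \<cdot>\<^sub>v w \<in> W"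
    and inv: "\<And>g w. g \<in> carrier P \<Longrightarrow> w \<in> W \<Longrightarrow> \<rho> g *\<^sub>v w \<in> W"
    and v: "v \<in> W" "v \<noteq> 0\<^sub>v n"
  shows "W = carrier_vec n"
proof -
  have "VectorSpace.subspace class_ring W (module_vec TYPE(complex) n)"
    unfolding VectorSpace.subspace_def submodule_def
    using W add smult vec_vs[where 'a = complex] vec_module[where 'a = complex]
    by (auto simp: module_vec_simps class_ring_simps)
  then show ?thesis using irr inv v by (auto simp: irreducible_representation_def)
qed

text \<open>The translates of \<open>v\<close> by powers of \<open>x\<close> stay in the joint
  eigenspace of \<open>A\<close>. Their Fourier components over the cyclic group of \<open>x\<close>
  are eigenvectors of \<open>\<rho> x\<close> or zero, and add up to a nonzero multiple of
  \<open>v\<close>, so one of them is nonzero.\<close>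

lemma exists_eigenvector:
  assumes v: "v \<in> carrier_vec n" "v \<noteq> 0\<^sub>v n" and x: "x \<in> carrier P" and A: "A \<subseteq> carrier P"
    and eig: "\<And>a. a \<in> A \<Longrightarrow> \<rho> a *\<^sub>v v = \<mu> a \<cdot>\<^sub>v v"
    and inv: "\<And>w. w \<in> carrier_vec n \<Longrightarrow> (\<And>a. a \<in> A \<Longrightarrow> \<rho> a *\<^sub>v w = \<mu> a \<cdot>\<^sub>v w) \<Longrightarrow>
      (\<And>a. a \<in> A \<Longrightarrow> \<rho> a *\<^sub>v (\<rho> x *\<^sub>v w) = \<mu> a \<cdot>\<^sub>v (\<rho> x *\<^sub>v w))"
  shows "\<exists>w c. w \<in> carrier_vec n \<and> w \<noteq> 0\<^sub>v n \<and> (\<forall>a\<in>A. \<rho> a *\<^sub>v w = \<mu> a \<cdot>\<^sub>v w) \<and>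
    \<rho> x *\<^sub>v w = c \<cdot>\<^sub>v w"
proof -
  define m where "m = Coset.order P"
  have m: "m > 0" using fin by (simp add: m_def order_gt_0_iff_finite)
  have xm: "x [^] m = \<one>" using x by (simp add: m_def pow_order_eq_1)
  define \<omega> where "\<omega> = cis (2 * pi / real m)"
  have \<omega>m: "\<omega> ^ m = 1" using m by (simp add: \<omega>_def DeMoivre)
  have \<omega>0: "\<omega> \<noteq> 0" by (simp add: \<omega>_def)
  define u where "u t = \<rho> (x [^] t) *\<^sub>v v" for t :: nat
  have u: "u t \<in> carrier_vec n" for t using x v by (simp add: u_def)
  have dim_u [simp]: "dim_vec (u t) = n" for t using u by (rule carrier_vecD)
  have u_Suc: "u (Suc t) = \<rho> x *\<^sub>v u t" for t
    using x v by (simp add: u_def rho_mult_vec[symmetric] nat_pow_Suc2[symmetric] del: nat_pow_Suc)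
  have u_eig: "\<rho> a *\<^sub>v u t = \<mu> a \<cdot>\<^sub>v u t" if "a \<in> A" for a t
    using that
  proof (induction t arbitrary: a)
    case 0
    then show ?case using eig v by (simp add: u_def rho_one)
  next
    case (Suc t)
    show ?case unfolding u_Suc by (rule inv[OF u Suc.IH Suc.prems])
  qed
  define w where "w j = vec_sum n (\<lambda>t. \<omega> ^ (j * t) \<cdot>\<^sub>v u t) {..<m}" for j
  have "\<exists>j. w j \<noteq> 0\<^sub>v n"
  proof (rule ccontr)
    assume none: "\<not> (\<exists>j. w j \<noteq> 0\<^sub>v n)"
    have "v $ i = 0" if i: "i < n" for i
    proof -
      \<comment> \<open>Fourier inversion: summing over \<open>j\<close> leaves only the term
        \<open>t = 0\<close>.\<close>
      have "0 = (\<Sum>j<m. w j $ i)" using none i by simp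
      also have "\<dots> = (\<Sum>j<m. \<Sum>t<m. \<omega> ^ (j * t) * u t $ i)"
        using i by (simp add: w_def vec_sum_def)
      also have "\<dots> = (\<Sum>t<m. (\<Sum>j<m. \<omega> ^ (j * t)) * u t $ i)"
        by (subst sum.swap) (simp add: sum_distrib_right)
      also have "\<dots> = (\<Sum>t<m. if t = 0 then of_nat m * u 0 $ i else 0)"
        using sum_root_of_unity_powers[of _ m] unfolding \<omega>_def by (intro sum.cong) auto
      also have "\<dots> = of_nat m * v $ i"
        using m v by (simp add: u_def rho_one)
      finally show ?thesis using m by simp
    qed
    then have "v = 0\<^sub>v n" using v by (intro eq_vecI) auto
    then show False using v by simp
  qed
  then obtain j where j: "w j \<noteq> 0\<^sub>v n" by blast
  have "\<rho> a *\<^sub>v w j = \<mu> a \<cdot>\<^sub>v w j" if a: "a \<in> A" for a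
  proof -
    have aP: "a \<in> carrier P" using a A by blast
    have "\<rho> a *\<^sub>v w j = vec_sum n (\<lambda>t. \<rho> a *\<^sub>v (\<omega> ^ (j * t) \<cdot>\<^sub>v u t)) {..<m}"
      unfolding w_def by (rule mult_vec_sum) (use rho_carrier[OF aP] u in auto)
    also have "\<dots> = vec_sum n (\<lambda>t. \<mu> a \<cdot>\<^sub>v (\<omega> ^ (j * t) \<cdot>\<^sub>v u t)) {..<m}"
      by (rule vec_sum_cong) (simp add: rho_smult[OF aP u] u_eig[OF a] smult_smult_assoc mult.commute)
    also have "\<dots> = \<mu> a \<cdot>\<^sub>v w j" unfolding w_def by (rule smult_vec_sum[symmetric]) (use u in auto)
    finally show ?thesis .
  qed
  moreover have "\<rho> x *\<^sub>v w j = inverse (\<omega> ^ j) \<cdot>\<^sub>v w j"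
  proof -
    have "\<rho> x *\<^sub>v w j = vec_sum n (\<lambda>t. \<rho> x *\<^sub>v (\<omega> ^ (j * t) \<cdot>\<^sub>v u t)) {..<m}"
      unfolding w_def by (rule mult_vec_sum) (use rho_carrier[OF x] u in auto)
    \<comment> \<open>\<open>\<rho> x\<close> shifts the index by one, at the cost of the factor
      \<open>inverse (\<omega> ^ j)\<close>; the shift is cyclic because
      \<open>x [^] m = \<one>\<close>.\<close>
    also have "\<dots> = vec_sum n (\<lambda>t. inverse (\<omega> ^ j) \<cdot>\<^sub>v (\<omega> ^ (j * Suc t) \<cdot>\<^sub>v u (Suc t))) {..<m}"
    proof (rule vec_sum_cong)
      fix t
      have "inverse (\<omega> ^ j) * \<omega> ^ (j * Suc t) = \<omega> ^ (j * t)" using \<omega>0 by (simp add: power_add)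
      then show "\<rho> x *\<^sub>v (\<omega> ^ (j * t) \<cdot>\<^sub>v u t) = inverse (\<omega> ^ j) \<cdot>\<^sub>v (\<omega> ^ (j * Suc t) \<cdot>\<^sub>v u (Suc t))"
        by (simp only: rho_smult[OF x u] u_Suc smult_smult_assoc)
    qed
    also have "\<dots> = inverse (\<omega> ^ j) \<cdot>\<^sub>v vec_sum n (\<lambda>t. \<omega> ^ (j * Suc t) \<cdot>\<^sub>v u (Suc t)) {..<m}"
      by (rule smult_vec_sum[symmetric]) (use u in auto)
    also have "vec_sum n (\<lambda>t. \<omega> ^ (j * Suc t) \<cdot>\<^sub>v u (Suc t)) {..<m} = w j"
    proof (rule eq_vecI)
      fix i assume "i < dim_vec (w j)"
      then have i: "i < n" by (simp add: w_def vec_sum_def)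
      have um: "u m = u 0" using xm by (simp add: u_def)
      have "(\<Sum>t<m. \<omega> ^ (j * Suc t) * u (Suc t) $ i) + \<omega> ^ (j * 0) * u 0 $ i
          = (\<Sum>t<Suc m. \<omega> ^ (j * t) * u t $ i)"
        by (subst sum.lessThan_Suc_shift) (simp add: add.commute)
      also have "\<dots> = (\<Sum>t<m. \<omega> ^ (j * t) * u t $ i) + \<omega> ^ (j * 0) * u 0 $ i"
        using \<omega>m um by (simp add: mult.commute[of j] power_mult)
      finally show "vec_sum n (\<lambda>t. \<omega> ^ (j * Suc t) \<cdot>\<^sub>v u (Suc t)) {..<m} $ i = w j $ i"
        using i by (simp add: w_def vec_sum_def)
    qed (simp add: w_def vec_sum_def)
    finally show ?thesis .
  qed
  moreover have "w j \<in> carrier_vec n" by (simp add: w_def)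
  ultimately show ?thesis using j by blast
qed

section \<open>Stabilizers of lines\<close>

definition line_stab :: "complex vec \<Rightarrow> 'a set" where
  "line_stab v = {g \<in> carrier P. \<exists>c. \<rho> g *\<^sub>v v = c \<cdot>\<^sub>v v}"

lemma smult_eq_iff:
  assumes "v \<in> carrier_vec n" "v \<noteq> 0\<^sub>v n"
  shows "c \<cdot>\<^sub>v v = d \<cdot>\<^sub>v v \<longleftrightarrow> c = (d::complex)"
proof
  assume eq: "c \<cdot>\<^sub>v v = d \<cdot>\<^sub>v v"
  obtain i where "i < n" "v $ i \<noteq> 0"
    using assms by (metis eq_vecI carrier_vecD index_zero_vec)
  then show "c = d" using arg_cong[OF eq, of "\<lambda>w. w $ i"] assms by simp
qed simp

lemma line_stab_subgroup:
  assumes v: "v \<in> carrier_vec n" "v \<noteq> 0\<^sub>v n"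
  shows "subgroup (line_stab v) P"
proof (rule subgroupI)
  show "line_stab v \<subseteq> carrier P" by (auto simp: line_stab_def)
  have "\<rho> \<one> *\<^sub>v v = 1 \<cdot>\<^sub>v v" using v by (simp add: rho_one)
  then show "line_stab v \<noteq> {}" unfolding line_stab_def by blast
next
  fix g assume "g \<in> line_stab v"
  then obtain c where g: "g \<in> carrier P" "\<rho> g *\<^sub>v v = c \<cdot>\<^sub>v v" by (auto simp: line_stab_def)
  have "v = \<rho> (inv g \<otimes> g) *\<^sub>v v" using g v by (simp add: rho_one)
  also have "\<dots> = c \<cdot>\<^sub>v (\<rho> (inv g) *\<^sub>v v)"
    using g v rho_mult_vec[of "inv g" g v] rho_smult[of "inv g" v c] by simp
  finally have eq: "v = c \<cdot>\<^sub>v (\<rho> (inv g) *\<^sub>v v)" .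
  have "c \<noteq> 0"
  proof
    assume "c = 0"
    then have "c \<cdot>\<^sub>v (\<rho> (inv g) *\<^sub>v v) = 0\<^sub>v n"
      using carrier_vecD[OF rho_vec[OF inv_closed[OF g(1)] v(1)]] by (intro eq_vecI) auto
    then show False using eq v by simp
  qed
  then have "inverse c \<cdot>\<^sub>v v = \<rho> (inv g) *\<^sub>v v"
    by (subst eq) (simp add: smult_smult_assoc)
  then show "inv g \<in> line_stab v" using g unfolding line_stab_def by (auto intro: sym)
next
  fix g h assume "g \<in> line_stab v" "h \<in> line_stab v"
  then obtain c d where gh: "g \<in> carrier P" "\<rho> g *\<^sub>v v = c \<cdot>\<^sub>v v" "h \<in> carrier P" "\<rho> h *\<^sub>v v = d \<cdot>\<^sub>v v"
    by (auto simp: line_stab_def)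
  then have "\<rho> (g \<otimes> h) *\<^sub>v v = (d * c) \<cdot>\<^sub>v v"
    using v by (simp add: rho_mult_vec rho_smult smult_smult_assoc)
  then show "g \<otimes> h \<in> line_stab v" using gh unfolding line_stab_def by blast
qed

lemma exists_maximal_line_stab:
  assumes ex: "\<exists>v. v \<in> carrier_vec n \<and> v \<noteq> 0\<^sub>v n \<and> D \<subseteq> line_stab v"
  obtains v where "v \<in> carrier_vec n" "v \<noteq> 0\<^sub>v n" "D \<subseteq> line_stab v"
    "\<And>w. w \<in> carrier_vec n \<Longrightarrow> w \<noteq> 0\<^sub>v n \<Longrightarrow> line_stab v \<subseteq> line_stab w \<Longrightarrow> line_stab w = line_stab v"
proof -
  let ?Q = "\<lambda>v. v \<in> carrier_vec n \<and> v \<noteq> 0\<^sub>v n \<and> D \<subseteq> line_stab v"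
  have fls: "finite (line_stab v)" for v using fin by (simp add: line_stab_def)
  have "card (line_stab v) < Suc (card (carrier P))" for v
    using fin by (auto simp: less_Suc_eq_le line_stab_def intro!: card_mono)
  then obtain v where v: "?Q v" "\<And>w. ?Q w \<Longrightarrow> card (line_stab w) \<le> card (line_stab v)"
    using ex_has_greatest_nat[of ?Q _ "\<lambda>v. card (line_stab v)" "Suc (card (carrier P))"] ex
    by (metis order_less_imp_le)
  show thesis
  proof (rule that)
    fix w assume w: "w \<in> carrier_vec n" "w \<noteq> 0\<^sub>v n" "line_stab v \<subseteq> line_stab w"
    then have "card (line_stab w) \<le> card (line_stab v)" using v by blast
    then show "line_stab w = line_stab v" using w(3) fls card_seteq by metis
  qed (use v in auto)
qed

text \<open>Elements are added one at a time: a new \<open>x\<close> commutes with the earlier ones,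
  so it preserves their joint eigenspace and has an eigenvector there.\<close>

lemma exists_common_eigenvector:
  assumes D: "D \<subseteq> carrier P" and comm: "\<And>a b. a \<in> D \<Longrightarrow> b \<in> D \<Longrightarrow> a \<otimes> b = b \<otimes> a"
  shows "\<exists>v. v \<in> carrier_vec n \<and> v \<noteq> 0\<^sub>v n \<and> D \<subseteq> line_stab v"
proof -
  have n: "0 < n" using irr by (simp add: irreducible_representation_def)
  have finD: "finite D" using finite_subset[OF D fin] .
  have "\<exists>v. v \<in> carrier_vec n \<and> v \<noteq> 0\<^sub>v n \<and> E \<subseteq> line_stab v" if "finite E" "E \<subseteq> D" for E
    using that
  proof (induction E)
    case empty
    have "unit_vec n 0 \<noteq> (0\<^sub>v n :: complex vec)"
    proof
      assume "unit_vec n 0 = (0\<^sub>v n :: complex vec)"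
      from arg_cong[OF this, of "\<lambda>w. w $ 0"] show False using n by simp
    qed
    then show ?case by (intro exI[of _ "unit_vec n 0"]) simp
  next
    case (insert x E)
    then obtain v where v: "v \<in> carrier_vec n" "v \<noteq> 0\<^sub>v n" "E \<subseteq> line_stab v" by auto
    have "\<forall>a\<in>E. \<exists>c. \<rho> a *\<^sub>v v = c \<cdot>\<^sub>v v" using v by (auto simp: line_stab_def)
    then obtain \<mu> where \<mu>: "\<And>a. a \<in> E \<Longrightarrow> \<rho> a *\<^sub>v v = \<mu> a \<cdot>\<^sub>v v" by metis
    have xD: "x \<in> D" and ED: "E \<subseteq> D" and xP: "x \<in> carrier P" and EP: "E \<subseteq> carrier P"
      using insert.prems D by auto
    have inv: "\<rho> a *\<^sub>v (\<rho> x *\<^sub>v u) = \<mu> a \<cdot>\<^sub>v (\<rho> x *\<^sub>v u)"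
      if u: "u \<in> carrier_vec n" "\<And>a. a \<in> E \<Longrightarrow> \<rho> a *\<^sub>v u = \<mu> a \<cdot>\<^sub>v u" and a: "a \<in> E" for u a
    proof -
      have aP: "a \<in> carrier P" using a EP by blast
      have "\<rho> a *\<^sub>v (\<rho> x *\<^sub>v u) = \<rho> (a \<otimes> x) *\<^sub>v u" using aP xP u by (simp add: rho_mult_vec)
      also have "a \<otimes> x = x \<otimes> a" using comm a ED xD by blast
      also have "\<rho> (x \<otimes> a) *\<^sub>v u = \<mu> a \<cdot>\<^sub>v (\<rho> x *\<^sub>v u)"
        using aP xP u a by (simp add: rho_mult_vec rho_smult)
      finally show ?thesis .
    qed
    obtain w c where w: "w \<in> carrier_vec n" "w \<noteq> 0\<^sub>v n" "\<forall>a\<in>E. \<rho> a *\<^sub>v w = \<mu> a \<cdot>\<^sub>v w"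
      "\<rho> x *\<^sub>v w = c \<cdot>\<^sub>v w"
      using exists_eigenvector[OF v(1,2) xP EP \<mu> inv] by blast
    then have "insert x E \<subseteq> line_stab w" using xP EP by (auto simp: line_stab_def)
    then show ?case using w by blast
  qed
  then show ?thesis using finD by blast
qed

text \<open>The conjugate is \<open>b\<close> times a commutator, so a subgroup containing the
  derived subgroup is normal.\<close>

lemma line_stab_conj:
  assumes v: "v \<in> carrier_vec n" "v \<noteq> 0\<^sub>v n" and D: "derived P (carrier P) \<subseteq> line_stab v"
    and x: "x \<in> carrier P" and b: "b \<in> line_stab v"
  shows "inv x \<otimes> b \<otimes> x \<in> line_stab v"
proof -
  have bP: "b \<in> carrier P" using b by (simp add: line_stab_def)
  have "inv b \<otimes> inv x \<otimes> inv (inv b) \<otimes> inv (inv x) \<in> derived_set P (carrier P)"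
    using inv_closed[OF bP] inv_closed[OF x] by blast
  then have "inv b \<otimes> inv x \<otimes> b \<otimes> x \<in> line_stab v"
    using D bP x by (auto simp: derived_def intro: generate.incl)
  then have "b \<otimes> (inv b \<otimes> inv x \<otimes> b \<otimes> x) \<in> line_stab v"
    using b subgroup.m_closed[OF line_stab_subgroup[OF v]] by blast
  moreover have "b \<otimes> (inv b \<otimes> inv x \<otimes> b \<otimes> x) = inv x \<otimes> b \<otimes> x"
    using bP x by (simp add: m_assoc[symmetric])
  ultimately show ?thesis by simp
qed

end

section \<open>Induction from a linear character\<close>

lemma smult_mat_mult_vec:
  fixes A :: "complex mat"
  assumes "A \<in> carrier_mat n n" "w \<in> carrier_vec n"
  shows "(c \<cdot>\<^sub>m A) *\<^sub>v w = c \<cdot>\<^sub>v (A *\<^sub>v w)"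
  using assms by (intro eq_vecI) (auto simp: scalar_prod_def sum_distrib_left mult.assoc)

lemma mult_mat_zero_vec:
  fixes A :: "complex mat"
  assumes "A \<in> carrier_mat n n"
  shows "A *\<^sub>v 0\<^sub>v n = 0\<^sub>v n"
  using assms by (intro eq_vecI) (auto simp: scalar_prod_def)

text \<open>\<open>inertia\<close> is Mackey's irreducibility criterion for the character of
  \<open>P\<close> induced from \<mu>.\<close>

locale eigenline = irreducible_rep P n \<rho> for P (structure) and n and \<rho> +
  fixes v :: "complex vec" and B :: "'a set" and \<mu> :: "'a \<Rightarrow> complex"
  assumes v: "v \<in> carrier_vec n" "v \<noteq> 0\<^sub>v n" and B: "subgroup B P"
    and eig: "b \<in> B \<Longrightarrow> \<rho> b *\<^sub>v v = \<mu> b \<cdot>\<^sub>v v"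
    and inertia: "x \<in> carrier P \<Longrightarrow> x \<notin> B \<Longrightarrow>
      \<exists>b\<in>B. inv x \<otimes> b \<otimes> x \<in> B \<and> \<mu> (inv x \<otimes> b \<otimes> x) \<noteq> \<mu> b"
begin

lemma BP: "b \<in> B \<Longrightarrow> b \<in> carrier P"
  by (rule subgroup.mem_carrier[OF B])

abbreviation cardB :: complex where "cardB \<equiv> of_nat (card B)"

lemma cardB_nonzero: "cardB \<noteq> 0"
  using finite_subset[OF subgroup.subset[OF B] fin] subgroup.one_closed[OF B] by auto

lemma zero_smult_v: "0 \<cdot>\<^sub>v v = 0\<^sub>v n"
  using v by (intro eq_vecI) auto

lemma \<mu>_mult:
  assumes "b \<in> B" "c \<in> B"
  shows "\<mu> (b \<otimes> c) = \<mu> b * \<mu> c"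
proof -
  have "\<mu> (b \<otimes> c) \<cdot>\<^sub>v v = \<rho> b *\<^sub>v (\<rho> c *\<^sub>v v)"
    using assms BP v eig[OF subgroup.m_closed[OF B assms]] by (simp add: rho_mult_vec)
  also have "\<dots> = (\<mu> c * \<mu> b) \<cdot>\<^sub>v v"
    using assms BP v eig by (simp add: rho_smult smult_smult_assoc)
  finally show ?thesis using smult_eq_iff[OF v] by (simp add: mult.commute)
qed

lemma \<mu>_one: "\<mu> \<one> = 1"
  using eig[OF subgroup.one_closed[OF B]] v smult_eq_iff[OF v, of 1 "\<mu> \<one>"] by (simp add: rho_one)

lemma \<mu>_inv: "b \<in> B \<Longrightarrow> \<mu> (inv b) * \<mu> b = 1"
  using \<mu>_mult[of "inv b" b] subgroup.m_inv_closed[OF B] BP \<mu>_one by simp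

text \<open>The operator \<open>e\<close> is \<open>|B|\<close> times the projection onto the line of \<open>v\<close> along the lines of its
  translates \<open>\<rho> x *\<^sub>v v\<close>, \<open>x \<notin> B\<close>; irreducibility shows that it has rank one and that its
  conjugates add up to a scalar.\<close>

definition e :: "complex mat" where
  "e = mat_sum n (\<lambda>b. \<mu> (inv b) \<cdot>\<^sub>m \<rho> b) B"

lemma e: "e \<in> carrier_mat n n"
  by (simp add: e_def)

lemma e_carrier [simp]: "w \<in> carrier_vec n \<Longrightarrow> e *\<^sub>v w \<in> carrier_vec n"
  using e by simp

lemma e_vec:
  assumes w: "w \<in> carrier_vec n"
  shows "e *\<^sub>v w = vec_sum n (\<lambda>b. \<mu> (inv b) \<cdot>\<^sub>v (\<rho> b *\<^sub>v w)) B"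
proof -
  have "e *\<^sub>v w = vec_sum n (\<lambda>b. (\<mu> (inv b) \<cdot>\<^sub>m \<rho> b) *\<^sub>v w) B"
    unfolding e_def by (rule mat_sum_mult_vec[OF w]) (use rho_carrier BP in simp)
  also have "\<dots> = vec_sum n (\<lambda>b. \<mu> (inv b) \<cdot>\<^sub>v (\<rho> b *\<^sub>v w)) B"
    by (rule vec_sum_cong) (rule smult_mat_mult_vec[OF rho_carrier[OF BP] w])
  finally show ?thesis .
qed

lemma e_smult: "w \<in> carrier_vec n \<Longrightarrow> e *\<^sub>v (c \<cdot>\<^sub>v w) = c \<cdot>\<^sub>v (e *\<^sub>v w)"
  by (rule mult_mat_vec[OF e])

lemma e_b:
  assumes b: "b \<in> B" and w: "w \<in> carrier_vec n"
  shows "e *\<^sub>v (\<rho> b *\<^sub>v w) = \<mu> b \<cdot>\<^sub>v (e *\<^sub>v w)"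
proof -
  let ?F = "\<lambda>c. \<mu> (inv c) \<cdot>\<^sub>v (\<rho> c *\<^sub>v w)"
  have bP: "b \<in> carrier P" using b BP by blast
  have "e *\<^sub>v (\<rho> b *\<^sub>v w) = vec_sum n (\<lambda>c. \<mu> (inv c) \<cdot>\<^sub>v (\<rho> c *\<^sub>v (\<rho> b *\<^sub>v w))) B"
    using e_vec rho_vec[OF bP w] by blast
  also have "\<dots> = vec_sum n (\<lambda>c. \<mu> b \<cdot>\<^sub>v ?F (c \<otimes> b)) B"
  proof (rule vec_sum_cong)
    fix c assume c: "c \<in> B"
    have cP: "c \<in> carrier P" using c BP by blast
    have "\<mu> (inv (c \<otimes> b)) = \<mu> (inv b) * \<mu> (inv c)"
      using \<mu>_mult[of "inv b" "inv c"] b c cP bP subgroup.m_inv_closed[OF B] by (simp add: inv_mult_group)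
    then have "\<mu> b * \<mu> (inv (c \<otimes> b)) = \<mu> (inv c)" using \<mu>_inv[OF b] by (simp add: mult.left_commute mult.commute)
    then show "\<mu> (inv c) \<cdot>\<^sub>v (\<rho> c *\<^sub>v (\<rho> b *\<^sub>v w)) = \<mu> b \<cdot>\<^sub>v ?F (c \<otimes> b)"
      using cP bP w by (simp add: rho_mult_vec smult_smult_assoc)
  qed
  also have "\<dots> = \<mu> b \<cdot>\<^sub>v vec_sum n (\<lambda>c. ?F (c \<otimes> b)) B"
    by (rule smult_vec_sum[symmetric]) (use bP BP w in simp)
  also have "vec_sum n (\<lambda>c. ?F (c \<otimes> b)) B = vec_sum n ?F B"
    unfolding vec_sum_def by (subst sum_translate_right[OF B b, of "\<lambda>c. ?F c $ _"]) simp
  finally show ?thesis by (simp add: e_vec[OF w])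
qed

lemma e_v: "e *\<^sub>v v = cardB \<cdot>\<^sub>v v"
proof -
  have "e *\<^sub>v v = vec_sum n (\<lambda>b. v) B"
    unfolding e_vec[OF v(1)]
    by (rule vec_sum_cong) (use v \<mu>_inv in \<open>simp add: eig smult_smult_assoc\<close>)
  also have "\<dots> = cardB \<cdot>\<^sub>v v" using v by (intro eq_vecI) (auto simp: vec_sum_def)
  finally show ?thesis .
qed

lemma e_B: "h \<in> B \<Longrightarrow> e *\<^sub>v (\<rho> h *\<^sub>v v) = (\<mu> h * cardB) \<cdot>\<^sub>v v"
  using e_b[of h v] v e_v by (simp add: smult_smult_assoc)

text \<open>Moving \<open>b\<close> across \<open>x\<close> evaluates \<open>e\<close> at
  \<open>\<rho> (b \<otimes> x) *\<^sub>v v\<close> in two ways, with the distinct factors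
  \<open>\<mu> b\<close> and \<open>\<mu> (inv x \<otimes> b \<otimes> x)\<close>.\<close>

lemma e_notB:
  assumes x: "x \<in> carrier P" "x \<notin> B"
  shows "e *\<^sub>v (\<rho> x *\<^sub>v v) = 0\<^sub>v n"
proof -
  obtain b where b: "b \<in> B" "inv x \<otimes> b \<otimes> x \<in> B" "\<mu> (inv x \<otimes> b \<otimes> x) \<noteq> \<mu> b"
    using inertia[OF x] by blast
  have bP: "b \<in> carrier P" using b BP by blast
  let ?w = "e *\<^sub>v (\<rho> x *\<^sub>v v)"
  have w: "?w \<in> carrier_vec n" using x v by simp
  have "\<mu> b \<cdot>\<^sub>v ?w = e *\<^sub>v (\<rho> (b \<otimes> x) *\<^sub>v v)"
    using e_b[OF b(1), of "\<rho> x *\<^sub>v v"] x bP v by (simp add: rho_mult_vec)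
  also have "b \<otimes> x = x \<otimes> (inv x \<otimes> b \<otimes> x)" using x bP by (simp add: m_assoc[symmetric])
  also have "e *\<^sub>v (\<rho> (x \<otimes> (inv x \<otimes> b \<otimes> x)) *\<^sub>v v) = \<mu> (inv x \<otimes> b \<otimes> x) \<cdot>\<^sub>v ?w"
    using x bP v eig[OF b(2)] by (simp add: rho_mult_vec[of x] rho_smult e_smult)
  finally show ?thesis using smult_eq_iff[OF w] b(3) by metis
qed


text \<open>The vectors all of whose translates are sent into the line of \<open>v\<close> form an
  invariant subspace, which contains \<open>v\<close> by \<open>e_B\<close> and
  \<open>e_notB\<close>.\<close>

lemma e_line:
  assumes w: "w \<in> carrier_vec n"
  shows "\<exists>c. e *\<^sub>v w = c \<cdot>\<^sub>v v"
proof -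
  let ?W = "{w \<in> carrier_vec n. \<forall>x\<in>carrier P. \<exists>c. e *\<^sub>v (\<rho> x *\<^sub>v w) = c \<cdot>\<^sub>v v}"
  have "?W = carrier_vec n"
  proof (rule invariant_eq_carrier[OF _ _ _ _ _ _ v(2)])
    have z: "e *\<^sub>v (\<rho> x *\<^sub>v 0\<^sub>v n) = 0 \<cdot>\<^sub>v v" if "x \<in> carrier P" for x
      by (simp only: mult_mat_zero_vec[OF rho_carrier[OF that]] mult_mat_zero_vec[OF e] zero_smult_v)
    show "0\<^sub>v n \<in> ?W" using z by auto
    show "u + w \<in> ?W" if uw: "u \<in> ?W" "w \<in> ?W" for u w
    proof -
      have "\<exists>c. e *\<^sub>v (\<rho> x *\<^sub>v (u + w)) = c \<cdot>\<^sub>v v" if x: "x \<in> carrier P" for x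
      proof -
        obtain c d where "e *\<^sub>v (\<rho> x *\<^sub>v u) = c \<cdot>\<^sub>v v" "e *\<^sub>v (\<rho> x *\<^sub>v w) = d \<cdot>\<^sub>v v" using uw x by blast
        then have "e *\<^sub>v (\<rho> x *\<^sub>v (u + w)) = (c + d) \<cdot>\<^sub>v v"
          using uw x e rho_carrier[OF x] v
          by (simp add: mult_add_distrib_mat_vec[of _ n n] add_smult_distrib_vec)
        then show ?thesis by blast
      qed
      then show ?thesis using uw by simp
    qed
    show "c \<cdot>\<^sub>v w \<in> ?W" if w: "w \<in> ?W" for c w
    proof -
      have "\<exists>d. e *\<^sub>v (\<rho> x *\<^sub>v (c \<cdot>\<^sub>v w)) = d \<cdot>\<^sub>v v" if x: "x \<in> carrier P" for x
      proof -
        obtain d where "e *\<^sub>v (\<rho> x *\<^sub>v w) = d \<cdot>\<^sub>v v" using w x by blast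
        then have "e *\<^sub>v (\<rho> x *\<^sub>v (c \<cdot>\<^sub>v w)) = (c * d) \<cdot>\<^sub>v v"
          using w x by (simp add: rho_smult e_smult smult_smult_assoc)
        then show ?thesis by blast
      qed
      then show ?thesis using w by simp
    qed
    show "\<rho> h *\<^sub>v w \<in> ?W" if h: "h \<in> carrier P" and w: "w \<in> ?W" for h w
      using h w by (auto simp: rho_mult_vec[symmetric])
    show "v \<in> ?W"
    proof -
      have "\<exists>c. e *\<^sub>v (\<rho> x *\<^sub>v v) = c \<cdot>\<^sub>v v" if x: "x \<in> carrier P" for x
      proof (cases "x \<in> B")
        case False
        then have "e *\<^sub>v (\<rho> x *\<^sub>v v) = 0 \<cdot>\<^sub>v v" using e_notB[OF x] zero_smult_v by simp
        then show ?thesis by blast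
      qed (use e_B in blast)
      then show ?thesis using v by simp
    qed
  qed auto
  then have "w \<in> ?W" using w by simp
  then have "\<exists>c. e *\<^sub>v (\<rho> \<one> *\<^sub>v w) = c \<cdot>\<^sub>v v" using one_closed by blast
  then show ?thesis using w by (simp add: rho_one)
qed

text \<open>By \<open>e_line\<close> the matrix \<open>e\<close> is the column \<open>v\<close>
  times a row \<open>\<phi>\<close>, so the trace is the value of \<open>\<phi>\<close> at
  \<open>\<rho> h *\<^sub>v v\<close>, which is \<open>c\<close>.\<close>

lemma trace_e:
  assumes h: "h \<in> carrier P" and c: "e *\<^sub>v (\<rho> h *\<^sub>v v) = c \<cdot>\<^sub>v v"
  shows "mat_trace (\<rho> h * e) = c"
proof -
  have "\<forall>k<n. \<exists>c. e *\<^sub>v unit_vec n k = c \<cdot>\<^sub>v v" using e_line by simp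
  then obtain \<phi> where \<phi>: "\<And>k. k < n \<Longrightarrow> e *\<^sub>v unit_vec n k = \<phi> k \<cdot>\<^sub>v v" by metis
  have e_entry: "e $$ (i, k) = \<phi> k * v $ i" if ik: "i < n" "k < n" for i k
  proof -
    have "e $$ (i, k) = (e *\<^sub>v unit_vec n k) $ i" using e ik by simp
    then show ?thesis using \<phi>[OF ik(2)] v ik by simp
  qed
  let ?w = "\<rho> h *\<^sub>v v"
  have w: "?w \<in> carrier_vec n" using h v by simp
  obtain j where j: "j < n" "v $ j \<noteq> 0"
    using v by (metis eq_vecI carrier_vecD index_zero_vec)
  have "c * v $ j = (e *\<^sub>v ?w) $ j" using c j v by simp
  also have "\<dots> = (\<Sum>k<n. e $$ (j, k) * ?w $ k)" by (rule index_mult_mat_vec_sum[OF e w j(1)])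
  also have "\<dots> = (\<Sum>k<n. \<phi> k * ?w $ k) * v $ j"
    using j by (simp add: e_entry sum_distrib_left sum_distrib_right mult_ac)
  finally have "c = (\<Sum>k<n. \<phi> k * ?w $ k)" using j by simp
  moreover have "mat_trace (\<rho> h * e) = (\<Sum>i<n. \<phi> i * (\<Sum>k<n. \<rho> h $$ (i, k) * v $ k))"
    unfolding mat_trace_mult[OF rho_carrier[OF h] e]
    by (simp add: e_entry sum_distrib_left mult_ac)
  moreover have "(\<Sum>k<n. \<rho> h $$ (i, k) * v $ k) = ?w $ i" if "i < n" for i
    using index_mult_mat_vec_sum[OF rho_carrier[OF h] v(1) that] by simp
  ultimately show ?thesis by simp
qed


section \<open>The sum of the conjugates of e and the trace formula\<close>

definition E :: "complex mat" where
  "E = mat_sum n (\<lambda>x. \<rho> x * (e * \<rho> (inv x))) (carrier P)"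

lemma E: "E \<in> carrier_mat n n"
  by (simp add: E_def)

lemma E_summand: "x \<in> carrier P \<Longrightarrow> \<rho> x * (e * \<rho> (inv x)) \<in> carrier_mat n n"
  using rho_carrier[of x] rho_carrier[OF inv_closed[of x]] e by simp

lemma E_vec:
  assumes w: "w \<in> carrier_vec n"
  shows "E *\<^sub>v w = vec_sum n (\<lambda>x. \<rho> x *\<^sub>v (e *\<^sub>v (\<rho> (inv x) *\<^sub>v w))) (carrier P)"
proof -
  have "E *\<^sub>v w = vec_sum n (\<lambda>x. (\<rho> x * (e * \<rho> (inv x))) *\<^sub>v w) (carrier P)"
    unfolding E_def by (rule mat_sum_mult_vec[OF w]) (rule E_summand)
  also have "\<dots> = vec_sum n (\<lambda>x. \<rho> x *\<^sub>v (e *\<^sub>v (\<rho> (inv x) *\<^sub>v w))) (carrier P)"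
  proof (rule vec_sum_cong)
    fix x assume x: "x \<in> carrier P"
    have c: "\<rho> x \<in> carrier_mat n n" "\<rho> (inv x) \<in> carrier_mat n n"
      using x rho_carrier by simp_all
    show "\<rho> x * (e * \<rho> (inv x)) *\<^sub>v w = \<rho> x *\<^sub>v (e *\<^sub>v (\<rho> (inv x) *\<^sub>v w))"
      using assoc_mult_mat_vec[OF c(1) mult_carrier_mat[OF e c(2)] w] assoc_mult_mat_vec[OF e c(2) w] by simp
  qed
  finally show ?thesis .
qed

text \<open>Only the \<open>card B\<close> summands with \<open>x \<in> B\<close> survive; in each
  of them the values of \<mu> at \<open>x\<close> and at its inverse cancel.\<close>

lemma E_v: "E *\<^sub>v v = (cardB * cardB) \<cdot>\<^sub>v v"
proof -
  have "E *\<^sub>v v = vec_sum n (\<lambda>x. (if x \<in> B then cardB else 0) \<cdot>\<^sub>v v) (carrier P)"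
    unfolding E_vec[OF v(1)]
  proof (rule vec_sum_cong)
    fix x assume x: "x \<in> carrier P"
    show "\<rho> x *\<^sub>v (e *\<^sub>v (\<rho> (inv x) *\<^sub>v v)) = (if x \<in> B then cardB else 0) \<cdot>\<^sub>v v"
    proof (cases "x \<in> B")
      case True
      have "\<rho> x *\<^sub>v (e *\<^sub>v (\<rho> (inv x) *\<^sub>v v)) = (\<mu> (inv x) * cardB * \<mu> x) \<cdot>\<^sub>v v"
        using e_B[OF subgroup.m_inv_closed[OF B True]] x v eig[OF True]
        by (simp add: rho_smult smult_smult_assoc)
      moreover have "\<mu> (inv x) * cardB * \<mu> x = cardB" using \<mu>_inv[OF True] by (simp add: mult.commute mult.left_commute)
      ultimately show ?thesis using True by simp
    next
      case False
      then have "inv x \<notin> B" using x subgroup.m_inv_closed[OF B, of "inv x"] by auto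
      then have "\<rho> x *\<^sub>v (e *\<^sub>v (\<rho> (inv x) *\<^sub>v v)) = 0\<^sub>v n"
        using e_notB x mult_mat_zero_vec[OF rho_carrier[OF x]] by simp
      then show ?thesis using False zero_smult_v by simp
    qed
  qed
  also have "\<dots> = (cardB * cardB) \<cdot>\<^sub>v v"
  proof (rule eq_vecI)
    fix i assume "i < dim_vec ((cardB * cardB) \<cdot>\<^sub>v v)"
    then have i: "i < n" using v by simp
    have "(\<Sum>x\<in>carrier P. if x \<in> B then cardB else 0) = cardB * cardB"
      using fin Int_absorb1[OF subgroup.subset[OF B]] by (simp add: sum.If_cases)
    then show "vec_sum n (\<lambda>x. (if x \<in> B then cardB else 0) \<cdot>\<^sub>v v) (carrier P) $ i = ((cardB * cardB) \<cdot>\<^sub>v v) $ i"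
      using i v by (simp add: vec_sum_def sum_distrib_right[symmetric])
  qed (use v in \<open>simp add: vec_sum_def\<close>)
  finally show ?thesis .
qed

lemma E_comm:
  assumes h: "h \<in> carrier P" and w: "w \<in> carrier_vec n"
  shows "E *\<^sub>v (\<rho> h *\<^sub>v w) = \<rho> h *\<^sub>v (E *\<^sub>v w)"
proof -
  let ?F = "\<lambda>y. \<rho> y *\<^sub>v (e *\<^sub>v (\<rho> (inv y) *\<^sub>v (\<rho> h *\<^sub>v w)))"
  have "\<rho> h *\<^sub>v (E *\<^sub>v w) = vec_sum n (\<lambda>x. \<rho> h *\<^sub>v (\<rho> x *\<^sub>v (e *\<^sub>v (\<rho> (inv x) *\<^sub>v w)))) (carrier P)"
    unfolding E_vec[OF w] by (rule mult_vec_sum[OF rho_carrier[OF h]]) (use w in simp)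
  also have "\<dots> = vec_sum n (\<lambda>x. ?F (h \<otimes> x)) (carrier P)"
  proof (rule vec_sum_cong)
    fix x assume x: "x \<in> carrier P"
    have "inv x = inv (h \<otimes> x) \<otimes> h" using h x by (simp add: inv_mult_group m_assoc)
    then have "\<rho> (inv x) *\<^sub>v w = \<rho> (inv (h \<otimes> x)) *\<^sub>v (\<rho> h *\<^sub>v w)"
      using h x w by (metis rho_mult_vec inv_closed m_closed)
    then show "\<rho> h *\<^sub>v (\<rho> x *\<^sub>v (e *\<^sub>v (\<rho> (inv x) *\<^sub>v w))) = ?F (h \<otimes> x)"
      using h x w by (simp add: rho_mult_vec[of h x])
  qed
  also have "\<dots> = vec_sum n ?F (carrier P)"
    unfolding vec_sum_def by (subst sum_translate[OF subgroup_self h, of "\<lambda>y. ?F y $ _"]) simp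
  also have "\<dots> = E *\<^sub>v (\<rho> h *\<^sub>v w)" using E_vec[of "\<rho> h *\<^sub>v w"] h w by simp
  finally show ?thesis by simp
qed

text \<open>Schur's lemma with the eigenvalue read off at \<open>v\<close>: the eigenspace is
  invariant because \<open>E\<close> commutes with the group.\<close>

lemma E_scalar:
  assumes w: "w \<in> carrier_vec n"
  shows "E *\<^sub>v w = (cardB * cardB) \<cdot>\<^sub>v w"
proof -
  let ?W = "{w \<in> carrier_vec n. E *\<^sub>v w = (cardB * cardB) \<cdot>\<^sub>v w}"
  have "?W = carrier_vec n"
  proof (rule invariant_eq_carrier[OF _ _ _ _ _ _ v(2)])
    have "(cardB * cardB) \<cdot>\<^sub>v 0\<^sub>v n = 0\<^sub>v n" by (intro eq_vecI) auto
    then show "0\<^sub>v n \<in> ?W" using mult_mat_zero_vec[OF E] by simp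
    show "u + w \<in> ?W" if "u \<in> ?W" "w \<in> ?W" for u w
      using that E by (simp add: mult_add_distrib_mat_vec[of _ n n] smult_add_distrib_vec[of _ n])
    show "c \<cdot>\<^sub>v w \<in> ?W" if "w \<in> ?W" for c w
      using that E by (simp add: mult_mat_vec[of _ n n] smult_smult_assoc mult.commute)
    show "\<rho> h *\<^sub>v w \<in> ?W" if "h \<in> carrier P" "w \<in> ?W" for h w
      using that by (simp add: E_comm rho_smult)
    show "v \<in> ?W" using v E_v by simp
  qed auto
  then show ?thesis using w by blast
qed

lemma E_entry:
  assumes ik: "i < n" "k < n"
  shows "E $$ (i, k) = (if i = k then cardB * cardB else 0)"
proof -
  have "E $$ (i, k) = (E *\<^sub>v unit_vec n k) $ i" using E ik by simp
  then show ?thesis using E_scalar[of "unit_vec n k"] ik by simp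
qed

text \<open>The formula for an induced character. The trace of \<open>\<rho> g * E\<close> is
  computed twice: \<open>E\<close> is scalar, and cyclicity of the trace reduces each summand of
  \<open>E\<close> to \<open>trace_e\<close>.\<close>

lemma trace_formula:
  assumes g: "g \<in> carrier P"
  shows "cardB * mat_trace (\<rho> g)
    = (\<Sum>x\<in>carrier P. if inv x \<otimes> g \<otimes> x \<in> B then \<mu> (inv x \<otimes> g \<otimes> x) else 0)"
proof -
  have "cardB * cardB * mat_trace (\<rho> g) = mat_trace (\<rho> g * E)"
  proof -
    have "mat_trace (\<rho> g * E) = (\<Sum>i<n. \<rho> g $$ (i, i) * (cardB * cardB))"
      unfolding mat_trace_mult[OF rho_carrier[OF g] E]
    proof (rule sum.cong[OF refl])
      fix i assume "i \<in> {..<n}"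
      then have i: "i < n" by simp
      have "(\<Sum>k<n. \<rho> g $$ (i, k) * E $$ (k, i))
          = (\<Sum>k<n. if k = i then \<rho> g $$ (i, i) * (cardB * cardB) else 0)"
        using i by (intro sum.cong) (auto simp: E_entry)
      then show "(\<Sum>k<n. \<rho> g $$ (i, k) * E $$ (k, i)) = \<rho> g $$ (i, i) * (cardB * cardB)"
        using i by simp
    qed
    also have "\<dots> = mat_trace (\<rho> g) * (cardB * cardB)"
      using rho_carrier[OF g] by (simp add: mat_trace_def sum_distrib_right)
    finally show ?thesis by (simp only: mult.commute)
  qed
  also have "\<dots> = mat_trace (mat_sum n (\<lambda>x. \<rho> g * (\<rho> x * (e * \<rho> (inv x)))) (carrier P))"
  proof -
    have "\<rho> g * E = mat_sum n (\<lambda>x. \<rho> g * (\<rho> x * (e * \<rho> (inv x)))) (carrier P)"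
      unfolding E_def by (rule mult_mat_sum[OF rho_carrier[OF g]]) (rule E_summand)
    then show ?thesis by (rule arg_cong)
  qed
  also have "\<dots> = (\<Sum>x\<in>carrier P. mat_trace (\<rho> g * (\<rho> x * (e * \<rho> (inv x)))))"
  proof (rule mat_trace_mat_sum)
    fix x assume x: "x \<in> carrier P"
    show "\<rho> g * (\<rho> x * (e * \<rho> (inv x))) \<in> carrier_mat n n"
      using mult_carrier_mat[OF rho_carrier[OF g] E_summand[OF x]] .
  qed
  also have "\<dots> = (\<Sum>x\<in>carrier P. cardB * (if inv x \<otimes> g \<otimes> x \<in> B then \<mu> (inv x \<otimes> g \<otimes> x) else 0))"
  proof (rule sum.cong)
    fix x assume x: "x \<in> carrier P"
    let ?h = "inv x \<otimes> g \<otimes> x"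
    have h: "?h \<in> carrier P" using x g by simp
    have c: "\<rho> g \<in> carrier_mat n n" "\<rho> x \<in> carrier_mat n n" "\<rho> (inv x) \<in> carrier_mat n n"
      using x g rho_carrier by simp_all
    have "\<rho> g * (\<rho> x * (e * \<rho> (inv x))) = (\<rho> g * \<rho> x * e) * \<rho> (inv x)"
    proof -
      have "\<rho> g * (\<rho> x * (e * \<rho> (inv x))) = \<rho> g * \<rho> x * (e * \<rho> (inv x))"
        by (rule assoc_mult_mat[symmetric, OF c(1,2) mult_carrier_mat[OF e c(3)]])
      also have "\<dots> = \<rho> g * \<rho> x * e * \<rho> (inv x)"
        by (rule assoc_mult_mat[symmetric, OF mult_carrier_mat[OF c(1,2)] e c(3)])
      finally show ?thesis .
    qed
    then have "mat_trace (\<rho> g * (\<rho> x * (e * \<rho> (inv x)))) = mat_trace (\<rho> (inv x) * (\<rho> g * \<rho> x * e))"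
      using mat_trace_mult_commute[OF mult_carrier_mat[OF mult_carrier_mat[OF c(1,2)] e] c(3)] by simp
    also have "\<rho> (inv x) * (\<rho> g * \<rho> x * e) = \<rho> ?h * e"
    proof -
      have "\<rho> ?h = \<rho> (inv x) * (\<rho> g * \<rho> x)"
        using x g by (simp add: m_assoc rho_mult)
      then show ?thesis
        using assoc_mult_mat[OF c(3) mult_carrier_mat[OF c(1,2)] e] by simp
    qed
    also have "mat_trace (\<rho> ?h * e) = cardB * (if ?h \<in> B then \<mu> ?h else 0)"
    proof (cases "?h \<in> B")
      case True
      then show ?thesis using trace_e[OF h e_B[OF True]] by simp
    next
      case False
      then have "e *\<^sub>v (\<rho> ?h *\<^sub>v v) = 0 \<cdot>\<^sub>v v" using e_notB[OF h False] zero_smult_v by simp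
      then show ?thesis using trace_e[OF h] False by simp
    qed
    finally show "mat_trace (\<rho> g * (\<rho> x * (e * \<rho> (inv x)))) = cardB * (if ?h \<in> B then \<mu> ?h else 0)" .
  qed simp
  also have "\<dots> = cardB * (\<Sum>x\<in>carrier P. if inv x \<otimes> g \<otimes> x \<in> B then \<mu> (inv x \<otimes> g \<otimes> x) else 0)"
    by (simp add: sum_distrib_left)
  finally show ?thesis using cardB_nonzero by (simp only: mult.assoc mult_cancel_left) simp
qed

end

text \<open>\<open>B\<close> is a maximal line stabilizer. An \<open>x\<close> fixing \<mu>
  preserves the eigenspace of \<mu>, which then contains an eigenvector of \<open>x\<close>; the
  stabilizer of its line contains \<open>B\<close> and \<open>x\<close>, so maximality puts
  \<open>x\<close> into \<open>B\<close>.\<close>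

lemma (in irreducible_rep) exists_eigenline:
  assumes meta: "metabelian P"
  shows "\<exists>v B \<mu>. eigenline P n \<rho> v B \<mu> \<and> derived P (carrier P) \<subseteq> B \<and>
    (\<forall>x\<in>carrier P. \<forall>b\<in>B. inv x \<otimes> b \<otimes> x \<in> B)"
proof -
  let ?D = "derived P (carrier P)"
  have DP: "?D \<subseteq> carrier P" by (rule derived_in_carrier) simp
  have "comm_group (P\<lparr>carrier := ?D\<rparr>)" using meta by (simp add: metabelian_def)
  then interpret D: comm_group "P\<lparr>carrier := ?D\<rparr>" .
  have comm: "a \<otimes> b = b \<otimes> a" if "a \<in> ?D" "b \<in> ?D" for a b
    using D.m_comm[of a b] that by simp
  obtain v where v: "v \<in> carrier_vec n" "v \<noteq> 0\<^sub>v n" "?D \<subseteq> line_stab v"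
    and max: "\<And>w. w \<in> carrier_vec n \<Longrightarrow> w \<noteq> 0\<^sub>v n \<Longrightarrow> line_stab v \<subseteq> line_stab w \<Longrightarrow> line_stab w = line_stab v"
    using exists_maximal_line_stab[OF exists_common_eigenvector[OF DP comm]] by metis
  define B where "B = line_stab v"
  have B: "subgroup B P" unfolding B_def by (rule line_stab_subgroup[OF v(1,2)])
  have BP: "b \<in> carrier P" if "b \<in> B" for b using that by (simp add: B_def line_stab_def)
  have conj: "inv x \<otimes> b \<otimes> x \<in> B" if "x \<in> carrier P" "b \<in> B" for x b
    using line_stab_conj[OF v that(1)] that(2) by (simp add: B_def)
  have "\<forall>b\<in>B. \<exists>c. \<rho> b *\<^sub>v v = c \<cdot>\<^sub>v v" by (simp add: B_def line_stab_def)
  then obtain \<mu> where eig: "\<And>b. b \<in> B \<Longrightarrow> \<rho> b *\<^sub>v v = \<mu> b \<cdot>\<^sub>v v" by metis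
  have inertia: "x \<in> B" if x: "x \<in> carrier P" and eq: "\<And>b. b \<in> B \<Longrightarrow> \<mu> (inv x \<otimes> b \<otimes> x) = \<mu> b" for x
  proof -
    have inv: "\<rho> b *\<^sub>v (\<rho> x *\<^sub>v u) = \<mu> b \<cdot>\<^sub>v (\<rho> x *\<^sub>v u)"
      if u: "u \<in> carrier_vec n" "\<And>a. a \<in> B \<Longrightarrow> \<rho> a *\<^sub>v u = \<mu> a \<cdot>\<^sub>v u" and b: "b \<in> B" for u b
    proof -
      let ?c = "inv x \<otimes> b \<otimes> x"
      have "\<rho> b *\<^sub>v (\<rho> x *\<^sub>v u) = \<rho> (b \<otimes> x) *\<^sub>v u" using BP[OF b] x u by (simp add: rho_mult_vec)
      also have "b \<otimes> x = x \<otimes> ?c" using BP[OF b] x by (simp add: m_assoc[symmetric])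
      also have "\<rho> (x \<otimes> ?c) *\<^sub>v u = \<rho> x *\<^sub>v (\<rho> ?c *\<^sub>v u)"
        using BP[OF b] x u by (intro rho_mult_vec) auto
      also have "\<dots> = \<mu> b \<cdot>\<^sub>v (\<rho> x *\<^sub>v u)"
        using u(2)[OF conj[OF x b]] eq[OF b] x u(1) by (simp add: rho_smult)
      finally show ?thesis .
    qed
    have "B \<subseteq> carrier P" using BP by blast
    from exists_eigenvector[OF v(1,2) x this eig inv]
    obtain w c where w: "w \<in> carrier_vec n" "w \<noteq> 0\<^sub>v n" "\<forall>a\<in>B. \<rho> a *\<^sub>v w = \<mu> a \<cdot>\<^sub>v w"
      "\<rho> x *\<^sub>v w = c \<cdot>\<^sub>v w" by blast
    have "line_stab v \<subseteq> line_stab w"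
    proof
      fix a assume "a \<in> line_stab v"
      then have "a \<in> B" by (simp add: B_def)
      then show "a \<in> line_stab w" using w(3) BP[of a] unfolding line_stab_def by blast
    qed
    then have "line_stab w = B" using max[OF w(1,2)] by (simp add: B_def)
    moreover have "x \<in> line_stab w" using w(4) x by (auto simp: line_stab_def)
    ultimately show ?thesis by blast
  qed
  have "eigenline P n \<rho> v B \<mu>"
  proof (intro eigenline.intro eigenline_axioms.intro irreducible_rep_axioms)
    show "\<exists>b\<in>B. inv x \<otimes> b \<otimes> x \<in> B \<and> \<mu> (inv x \<otimes> b \<otimes> x) \<noteq> \<mu> b" if "x \<in> carrier P" "x \<notin> B" for x
      using inertia[OF that(1)] that conj[OF that(1)] by blast
  qed (use v B eig in auto)
  moreover have "?D \<subseteq> B" using v by (simp add: B_def)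
  ultimately show ?thesis using conj by blast
qed

section \<open>The support of an irreducible character\<close>

text \<open>By orbit-stabilizer the centralizer orders within one class add up to the group order,
  and the classes inside \<open>S\<close> are disjoint.\<close>

lemma (in group) card_conj_classes_mult_order:
  assumes fin: "finite (carrier G)" and S: "S \<subseteq> carrier G"
  shows "card {C \<in> conj_classes G. C \<subseteq> S} * Coset.order G
    \<le> (\<Sum>b\<in>S. card {g \<in> carrier G. g \<otimes> b \<otimes> inv g = b})"
proof -
  let ?\<phi> = "\<lambda>g. \<lambda>h\<in>carrier G. g \<otimes> h \<otimes> inv g"
  interpret act: group_action G "carrier G" ?\<phi> by (rule action_by_conjugation)
  let ?Cs = "{C \<in> conj_classes G. C \<subseteq> S}"
  have orbits: "?Cs \<subseteq> orbits G (carrier G) ?\<phi>" by (auto simp: conj_classes_def)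
  have finS: "finite S" using finite_subset[OF S fin] .
  have "card ?Cs * Coset.order G = (\<Sum>C\<in>?Cs. \<Sum>b\<in>C. card (stabilizer G ?\<phi> b))"
    using act.card_stablizer_sum[OF fin] orbits by (simp add: subset_iff)
  also have "\<dots> = (\<Sum>b\<in>\<Union>?Cs. card (stabilizer G ?\<phi> b))"
  proof (rule sum.Union_disjoint[symmetric, unfolded comp_def])
    show "\<forall>C\<in>?Cs. finite C" using finS finite_subset by auto
    show "\<forall>C\<in>?Cs. \<forall>D\<in>?Cs. C \<noteq> D \<longrightarrow> C \<inter> D = {}" using act.disjoint_union orbits by blast
  qed
  also have "\<dots> \<le> (\<Sum>b\<in>S. card (stabilizer G ?\<phi> b))"
    using finS by (intro sum_mono2) auto
  also have "\<dots> = (\<Sum>b\<in>S. card {g \<in> carrier G. g \<otimes> b \<otimes> inv g = b})"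
    using S by (intro sum.cong refl arg_cong[of _ _ card]) (auto simp: stabilizer_def)
  finally show ?thesis .
qed

theorem theoremA:
  fixes P :: "('a, 'b) monoid_scheme" and p :: nat and \<chi> :: "'a \<Rightarrow> complex"
  assumes "prime p" and "p_group p P" and "metabelian P" and "\<chi> \<in> Irr P"
  shows "real (card {C \<in> conj_classes P. C \<subseteq> Supp P \<chi>})
           \<le> real (Coset.order P) / (char_degree P \<chi>)\<^sup>2
       \<and> (odd p \<longrightarrow> (\<forall>g \<in> Supp P \<chi>. real (group.ord P g)
           \<le> real (Coset.order P) / char_degree P \<chi> powr (3/2)))"
proof -
  have grp: "group P" and fin: "finite (carrier P)" using assms(2) by (auto simp: p_group_def)
  obtain k where k: "Coset.order P = p ^ k" using assms(2) by (auto simp: p_group_def)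
  interpret group P by (rule grp)
  obtain \<rho> n where \<chi>: "\<chi> = character_of P \<rho>" and irr: "irreducible_representation P n \<rho>"
    using assms(4) by (auto simp: Irr_def)
  interpret R: irreducible_rep P n \<rho> by unfold_locales (use fin irr in auto)
  obtain v B \<mu> where L: "eigenline P n \<rho> v B \<mu>" and D: "derived P (carrier P) \<subseteq> B"
    and conj': "\<forall>x\<in>carrier P. \<forall>b\<in>B. inv\<^bsub>P\<^esub> x \<otimes>\<^bsub>P\<^esub> b \<otimes>\<^bsub>P\<^esub> x \<in> B"
    using R.exists_eigenline[OF assms(3)] by blast
  interpret L: eigenline P n \<rho> v B \<mu> by (rule L)
  note B = L.B and \<mu>_mult = L.\<mu>_mult
  have conj: "inv\<^bsub>P\<^esub> x \<otimes>\<^bsub>P\<^esub> b \<otimes>\<^bsub>P\<^esub> x \<in> B" if "x \<in> carrier P" "b \<in> B" for x b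
    using conj' that by blast
  have \<mu>_nz: "\<mu> b \<noteq> 0" if "b \<in> B" for b using L.\<mu>_inv[OF that] by auto
  note BP = subgroup.mem_carrier[OF B]
  define pr where "pr b x = \<mu> (inv\<^bsub>P\<^esub> x \<otimes>\<^bsub>P\<^esub> b \<otimes>\<^bsub>P\<^esub> x)" for b x
  have pr_conj: "pr (inv\<^bsub>P\<^esub> g \<otimes>\<^bsub>P\<^esub> b \<otimes>\<^bsub>P\<^esub> g) x = pr b (g \<otimes>\<^bsub>P\<^esub> x)"
    if "g \<in> carrier P" "x \<in> carrier P" "b \<in> B" for g x b
    using that BP by (simp add: pr_def inv_mult_group m_assoc)
  \<comment> \<open>At \<open>x\<close>, the factor \<open>c\<close> acts as conjugation by
    \<open>?d \<in> B\<close>, which does not change the multiplicative function \<mu>.\<close>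
  have pr_inner: "pr b (c \<otimes>\<^bsub>P\<^esub> x) = pr b x" if c: "c \<in> B" and b: "b \<in> B" and x: "x \<in> carrier P" for b c x
  proof -
    let ?d = "inv\<^bsub>P\<^esub> x \<otimes>\<^bsub>P\<^esub> c \<otimes>\<^bsub>P\<^esub> x" and ?a = "inv\<^bsub>P\<^esub> x \<otimes>\<^bsub>P\<^esub> b \<otimes>\<^bsub>P\<^esub> x"
    have d: "?d \<in> B" "inv\<^bsub>P\<^esub> ?d \<in> B" and a: "?a \<in> B"
      using conj[OF x c] conj[OF x b] subgroup.m_inv_closed[OF B] by auto
    have "inv\<^bsub>P\<^esub> (c \<otimes>\<^bsub>P\<^esub> x) \<otimes>\<^bsub>P\<^esub> b \<otimes>\<^bsub>P\<^esub> (c \<otimes>\<^bsub>P\<^esub> x) = inv\<^bsub>P\<^esub> ?d \<otimes>\<^bsub>P\<^esub> (?a \<otimes>\<^bsub>P\<^esub> ?d)"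
    proof -
      have r: "x \<otimes>\<^bsub>P\<^esub> (inv\<^bsub>P\<^esub> x \<otimes>\<^bsub>P\<^esub> y) = y" if "y \<in> carrier P" for y
        using x that by (simp add: m_assoc[symmetric])
      show ?thesis using BP[OF c] BP[OF b] x by (simp add: inv_mult_group m_assoc r)
    qed
    then have "pr b (c \<otimes>\<^bsub>P\<^esub> x) = \<mu> (inv\<^bsub>P\<^esub> ?d) * (\<mu> ?a * \<mu> ?d)"
      using \<mu>_mult[OF d(2) subgroup.m_closed[OF B a d(1)]] \<mu>_mult[OF a d(1)] by (simp add: pr_def)
    also have "\<dots> = \<mu> (inv\<^bsub>P\<^esub> ?d \<otimes>\<^bsub>P\<^esub> (?d \<otimes>\<^bsub>P\<^esub> ?a))"
      using \<mu>_mult[OF d(2) subgroup.m_closed[OF B d(1) a]] \<mu>_mult[OF d(1) a] by simp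
    also have "inv\<^bsub>P\<^esub> ?d \<otimes>\<^bsub>P\<^esub> (?d \<otimes>\<^bsub>P\<^esub> ?a) = ?a"
      using BP[OF d(1)] BP[OF a] by (simp add: m_assoc[symmetric] del: inv_mult_group)
    finally show ?thesis by (simp add: pr_def)
  qed
  interpret C: conjugation_pairing P p k B pr
  proof (intro conjugation_pairing.intro conjugation_pairing_axioms.intro grp)
    show "pr (b \<otimes>\<^bsub>P\<^esub> c) x = pr b x * pr c x" if bc: "b \<in> B" "c \<in> B" and x: "x \<in> carrier P" for b c x
    proof -
      have "inv\<^bsub>P\<^esub> x \<otimes>\<^bsub>P\<^esub> (b \<otimes>\<^bsub>P\<^esub> c) \<otimes>\<^bsub>P\<^esub> x
          = (inv\<^bsub>P\<^esub> x \<otimes>\<^bsub>P\<^esub> b \<otimes>\<^bsub>P\<^esub> x) \<otimes>\<^bsub>P\<^esub> (inv\<^bsub>P\<^esub> x \<otimes>\<^bsub>P\<^esub> c \<otimes>\<^bsub>P\<^esub> x)"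
      proof -
        have r: "x \<otimes>\<^bsub>P\<^esub> (inv\<^bsub>P\<^esub> x \<otimes>\<^bsub>P\<^esub> y) = y" if "y \<in> carrier P" for y
          using x that by (simp add: m_assoc[symmetric])
        show ?thesis using BP[OF bc(1)] BP[OF bc(2)] x by (simp add: m_assoc r)
      qed
      then show ?thesis using \<mu>_mult[OF conj[OF x bc(1)] conj[OF x bc(2)]] by (simp add: pr_def)
    qed
    show "pr b (g \<otimes>\<^bsub>P\<^esub> (h \<otimes>\<^bsub>P\<^esub> x)) = pr b (h \<otimes>\<^bsub>P\<^esub> (g \<otimes>\<^bsub>P\<^esub> x))"
      if g: "g \<in> carrier P" and h: "h \<in> carrier P" and x: "x \<in> carrier P" and b: "b \<in> B" for g h x b
    proof -
      \<comment> \<open>Exchanging \<open>g\<close> and \<open>h\<close> costs a commutator; it lies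
        in \<open>B\<close> because \<open>B\<close> contains the derived subgroup, so
        \<open>pr_inner\<close> removes it.\<close>
      let ?c = "g \<otimes>\<^bsub>P\<^esub> h \<otimes>\<^bsub>P\<^esub> inv\<^bsub>P\<^esub> g \<otimes>\<^bsub>P\<^esub> inv\<^bsub>P\<^esub> h"
      have "?c \<in> derived_set P (carrier P)" using g h by blast
      then have c: "?c \<in> B" using D by (auto simp: derived_def intro: generate.incl)
      have "g \<otimes>\<^bsub>P\<^esub> (h \<otimes>\<^bsub>P\<^esub> x) = ?c \<otimes>\<^bsub>P\<^esub> (h \<otimes>\<^bsub>P\<^esub> (g \<otimes>\<^bsub>P\<^esub> x))"
      proof -
        have r: "inv\<^bsub>P\<^esub> h \<otimes>\<^bsub>P\<^esub> (h \<otimes>\<^bsub>P\<^esub> y) = y" "inv\<^bsub>P\<^esub> g \<otimes>\<^bsub>P\<^esub> (g \<otimes>\<^bsub>P\<^esub> y) = y" if "y \<in> carrier P" for y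
          using g h that by (simp_all add: m_assoc[symmetric])
        show ?thesis using g h x by (simp add: m_assoc r)
      qed
      then show ?thesis using pr_inner[OF c b, of "h \<otimes>\<^bsub>P\<^esub> (g \<otimes>\<^bsub>P\<^esub> x)"] g h x by simp
    qed
    show "g \<in> B \<longleftrightarrow> (\<forall>b\<in>B. \<forall>x\<in>carrier P. pr b (g \<otimes>\<^bsub>P\<^esub> x) = pr b x)" if g: "g \<in> carrier P" for g
    proof
      assume *: "\<forall>b\<in>B. \<forall>x\<in>carrier P. pr b (g \<otimes>\<^bsub>P\<^esub> x) = pr b x"
      have "\<mu> (inv\<^bsub>P\<^esub> g \<otimes>\<^bsub>P\<^esub> b \<otimes>\<^bsub>P\<^esub> g) = \<mu> b" if b: "b \<in> B" for b
      proof -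
        have "pr b (g \<otimes>\<^bsub>P\<^esub> \<one>\<^bsub>P\<^esub>) = pr b \<one>\<^bsub>P\<^esub>" using * b by blast
        then show ?thesis using g BP[OF b] by (simp add: pr_def)
      qed
      then show "g \<in> B" using L.inertia[OF g] by blast
    qed (use pr_inner in blast)
  qed (use assms(1) fin k B conj \<mu>_nz pr_conj in \<open>auto simp: pr_def\<close>)

  let ?b = "real (card B)"
  have b_pos: "card B > 0"
    using C.finB subgroup.one_closed[OF B] by (auto simp: card_gt_0_iff)
  have ord_pos: "Coset.order P > 0" using fin by (simp add: order_gt_0_iff_finite)
  \<comment> \<open>\<open>B\<close> is normal: for \<open>g\<close> in \<open>B\<close> every term
    of the trace formula is present, and for \<open>g\<close> outside \<open>B\<close> none
    is.\<close>
  have \<chi>_B: "of_nat (card B) * \<chi> g = (\<Sum>x\<in>carrier P. pr g x)" if "g \<in> B" for g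
  proof -
    have "of_nat (card B) * \<chi> g = of_nat (card B) * mat_trace (\<rho> g)"
      using BP[OF that] by (simp add: \<chi> character_of_def)
    also have "\<dots> = (\<Sum>x\<in>carrier P. pr g x)"
      unfolding L.trace_formula[OF BP[OF that]] using conj that by (intro sum.cong) (auto simp: pr_def)
    finally show ?thesis .
  qed
  have \<chi>_notB: "\<chi> g = 0" if g: "g \<in> carrier P" "g \<notin> B" for g
  proof -
    have "inv\<^bsub>P\<^esub> x \<otimes>\<^bsub>P\<^esub> g \<otimes>\<^bsub>P\<^esub> x \<notin> B" if x: "x \<in> carrier P" for x
    proof
      assume "inv\<^bsub>P\<^esub> x \<otimes>\<^bsub>P\<^esub> g \<otimes>\<^bsub>P\<^esub> x \<in> B"
      from C.conj_inv_closed[OF x this] have "g \<in> B"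
        using conjugation_is_surj[OF x g(1)] by simp
      then show False using g by blast
    qed
    then have "of_nat (card B) * mat_trace (\<rho> g) = 0" using L.trace_formula[OF g(1)] by simp
    then show ?thesis using b_pos g by (simp add: \<chi> character_of_def)
  qed
  have Supp: "Supp P \<chi> = {b \<in> B. (\<Sum>x\<in>carrier P. pr b x) \<noteq> 0}"
  proof (intro equalityI subsetI)
    fix g assume "g \<in> Supp P \<chi>"
    then have g: "g \<in> carrier P" "\<chi> g \<noteq> 0" by (auto simp: Supp_def)
    then have gB: "g \<in> B" using \<chi>_notB by blast
    then show "g \<in> {b \<in> B. (\<Sum>x\<in>carrier P. pr b x) \<noteq> 0}" using \<chi>_B[OF gB, symmetric] g b_pos by simp
  next
    fix g assume "g \<in> {b \<in> B. (\<Sum>x\<in>carrier P. pr b x) \<noteq> 0}"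
    then show "g \<in> Supp P \<chi>" using \<chi>_B[of g] BP[of g] by (auto simp: Supp_def)
  qed
  define N where "N = char_degree P \<chi>"
  \<comment> \<open>Evaluation at the identity: the degree is the index of \<open>B\<close>.\<close>
  have N: "?b * N = real (Coset.order P)"
  proof -
    have "of_nat (card B) * \<chi> \<one>\<^bsub>P\<^esub> = of_nat (Coset.order P)"
      using \<chi>_B[OF subgroup.one_closed[OF B]] C.pr_one by (simp add: Coset.order_def)
    from arg_cong[OF this, of Re] show ?thesis by (simp add: N_def char_degree_def)
  qed
  have N_pos: "N > 0"
    using N b_pos ord_pos by (metis of_nat_0_less_iff zero_less_mult_pos)

  have "real (card {C \<in> conj_classes P. C \<subseteq> Supp P \<chi>}) \<le> real (Coset.order P) / N\<^sup>2"
  proof -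
    have "card {C \<in> conj_classes P. C \<subseteq> Supp P \<chi>} * Coset.order P \<le> card B ^ 2"
    proof (rule le_trans[OF card_conj_classes_mult_order[OF fin]])
      show "Supp P \<chi> \<subseteq> carrier P" by (auto simp: Supp_def)
      show "(\<Sum>b\<in>Supp P \<chi>. card {g \<in> carrier P. g \<otimes>\<^bsub>P\<^esub> b \<otimes>\<^bsub>P\<^esub> inv\<^bsub>P\<^esub> g = b}) \<le> card B ^ 2"
        unfolding Supp by (rule C.sum_centralizers_le)
    qed
    then have "real (card {C \<in> conj_classes P. C \<subseteq> Supp P \<chi>} * Coset.order P) \<le> real (card B ^ 2)"
      by (simp only: of_nat_le_iff)
    \<comment> \<open>Writing |P| as \<open>card B\<close> times the degree lets one factor
      \<open>card B\<close> cancel.\<close>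
    then have "real (card {C \<in> conj_classes P. C \<subseteq> Supp P \<chi>}) * N * ?b \<le> ?b * ?b"
      by (simp add: N[symmetric] power2_eq_square mult_ac)
    then have "real (card {C \<in> conj_classes P. C \<subseteq> Supp P \<chi>}) * N \<le> ?b" using b_pos by simp
    then have "real (card {C \<in> conj_classes P. C \<subseteq> Supp P \<chi>}) \<le> ?b / N"
      using N_pos by (simp add: le_divide_eq)
    also have "\<dots> = real (Coset.order P) / N\<^sup>2"
      using N_pos by (simp add: N[symmetric] power2_eq_square)
    finally show ?thesis .
  qed
  moreover have "real (group.ord P g) \<le> real (Coset.order P) / N powr (3/2)"
    if odd: "odd p" and g: "g \<in> Supp P \<chi>" for g
  proof -
    let ?o = "real (group.ord P g)"
    have "Coset.order P * group.ord P g ^ 2 \<le> card B ^ 3"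
      using C.order_mult_ord_le[OF odd] g unfolding Supp by blast
    then have "real (Coset.order P * group.ord P g ^ 2) \<le> real (card B ^ 3)"
      by (simp only: of_nat_le_iff)
    then have "(N * ?o\<^sup>2) * ?b \<le> ?b\<^sup>2 * ?b"
      by (simp add: N[symmetric] power2_eq_square power3_eq_cube mult_ac)
    then have "N * ?o\<^sup>2 \<le> ?b\<^sup>2" using b_pos by simp
    then have "(sqrt N * ?o)\<^sup>2 \<le> ?b\<^sup>2" using N_pos by (simp add: power_mult_distrib)
    then have "sqrt N * ?o \<le> ?b" by (rule power2_le_imp_le) simp
    then have "?o \<le> ?b / sqrt N" using N_pos by (simp add: le_divide_eq mult.commute)
    also have "\<dots> = real (Coset.order P) / N powr (3/2)"
    proof -
      have "N powr (3/2) = N powr (1 + 1/2)" by simp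
      also have "\<dots> = N * sqrt N" using N_pos by (simp only: powr_add powr_half_sqrt powr_one less_imp_le)
      finally show ?thesis using N_pos by (simp add: N[symmetric])
    qed
    finally show ?thesis .
  qed
  ultimately show ?thesis by (simp add: N_def)
qed

end
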